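(* There exists a perfect difference set $\mathcal{A}\subseteq\mathbb{N}$ such that $$A(x)\gg x^{\sqrt{2}-1+o(1)},$$ that is, there exist a constant $C>0$ and a function $\eta(x)$ with $\eta(x)\to 0$ as $x\to\infty$ such that $A(x)\ge C\,x^{\sqrt2-1+\eta(x)}$ for all sufficiently large $x$.
   Context: $\mathbb{N}$ denotes the set of positive integers. For a set $\mathcal{A}$ of integers and an integer $u$, $d_{\mathcal{A}}(u)$ denotes the number of pairs $(a,a')\in\mathcal{A}\times\mathcal{A}$ with $u=a-a'$. The set $\mathcal{A}$ is a perfect difference set if $d_{\mathcal{A}}(u)=1$ for every integer $u\neq 0$. The counting function $A(x)$ counts the positive elements of $\mathcal{A}$ not exceeding $x$. *)

theory Defs
  imports Complex_Main
begin

(* Sets with infinitely many representations of u get the junk value 0 here;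
   this never equals the value 1 required in a perfect difference set. *)
definition diff_count :: "int set \<Rightarrow> int \<Rightarrow> nat" where
  "diff_count A u = card {(a, a'). a \<in> A \<and> a' \<in> A \<and> u = a - a'}"

definition perfect_difference_set :: "int set \<Rightarrow> bool" where
  "perfect_difference_set A \<longleftrightarrow> (\<forall>u. u \<noteq> 0 \<longrightarrow> diff_count A u = 1)"

definition counting_function :: "int set \<Rightarrow> real \<Rightarrow> nat" where
  "counting_function A x = card {a \<in> A. 0 < a \<and> real_of_int a \<le> x}"

end

theory Submission
  imports Defs "HOL-Number_Theory.Number_Theory" "HOL-Library.FuncSet" "HOL-Library.Infinite_Set"
    "HOL-Real_Asymp.Real_Asymp"
begin

text \<open>
  The set is obtained by completing a dense Sidon set, that is, a set in which every nonzero
  difference occurs at most once. Write \<open>\<gamma> = sqrt 2 - 1\<close>, the positive root of \<open>\<gamma>\<^sup>2 + 2 \<gamma> = 1\<close>.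

  \<^emph>\<open>The Sidon set.\<close> Let \<open>q 0, q 1, \<dots>\<close> be primes with \<open>q i\<close> about \<open>2 ^ (4 (i + 1)\<^sup>2)\<close>. A prime \<open>p\<close>
  of level \<open>k\<close> is encoded by the number \<open>code l k p\<close> whose \<open>i\<close>-th digit in a mixed radix system,
  for \<open>i < k\<close>, is the discrete logarithm of \<open>p\<close> modulo \<open>q i\<close> plus an offset. Two such numbers are
  added without carries, and the offsets make the levels of the summands visible. Hence, if
  \<open>code p + code r = code p' + code r'\<close> with \<open>p, p'\<close> of level \<open>k\<close> and \<open>r, r'\<close> of level \<open>j \<le> k\<close>, then
  \<open>p r \<equiv> p' r'\<close> modulo \<open>q i\<close> for \<open>i < j\<close> and \<open>p \<equiv> p'\<close> modulo \<open>q i\<close> for \<open>j \<le> i < k\<close>. If \<open>p r = p' r'\<close>,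
  unique factorisation shows that the two sums have the same summands. The remaining coincidences
  are rare: let \<open>2 ^ t k\<close> be the size of the primes of level \<open>k\<close> and \<open>2 ^ F k\<close>, up to lower order
  terms in the exponent, the product of the first \<open>k\<close> moduli. A given quadruple satisfies all
  \<open>k\<close> congruences for a proportion of about \<open>2 ^ (- F k)\<close> of the possible moduli, because an
  integer has few prime divisors. It cannot satisfy them at all unless \<open>F j \<le> t k + t j\<close>, because
  the first \<open>j\<close> moduli divide \<open>p r - p' r' \<noteq> 0\<close>. As there are at most \<open>2 ^ (2 t k + 2 t j)\<close>
  quadruples, an average choice of moduli spoils only a small proportion of the primes of level
  \<open>k\<close> as soon as \<open>t k + 2 t j\<close> stays below \<open>F k\<close> for all those \<open>j\<close>. With \<open>t = c F\<close> the condition on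
  \<open>j\<close> reads \<open>F j \<le> c / (1 - c) F k\<close>, so that one needs \<open>c + 2 c\<^sup>2 / (1 - c) \<le> 1\<close>; the largest such
  \<open>c\<close> is \<open>\<gamma>\<close>. Averaging (\<open>sum_card_bad_le\<close>) yields moduli that are good for finitely many levels,
  and a compactness argument (\<open>koenig_finite_choices\<close>) yields one sequence for all levels.
  Deleting the spoiled primes leaves a Sidon set (\<open>sidon_codes\<close>). The codes of level \<open>k\<close> are at
  most \<open>2 ^ (F k + O(k\<^sup>2))\<close>, where \<open>F k\<close> is asymptotic to \<open>4/3 k\<^sup>3\<close>, and there are
  \<open>2 ^ (\<gamma> F k - O(k\<^sup>2))\<close> of them. The only analytic input is Chebyshev's lower bound
  for the number of primes (\<open>card_primes_le_two_power\<close>).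

  \<^emph>\<open>The completion.\<close> A Sidon set \<open>B\<close> of multiples of \<open>3\<close> is completed in stages
  (\<open>sidon_extends_to_perfect_difference_set\<close>): whenever a difference \<open>d\<close> is missing, a pair
  \<open>x, x + d\<close> is added, with \<open>x\<close> enormous and neither element divisible by \<open>3\<close>. This congruence
  condition rules out the coincidences that involve three elements of \<open>B\<close>. All others involve at
  most two elements of \<open>B\<close> and prescribe their sum or difference, so by the Sidon property deleting
  a bounded number of large elements of \<open>B\<close> destroys them. Since \<open>x\<close> may be as large as one likes,
  only logarithmically many elements are ever deleted below a given bound, which does not affect
  the exponent.
\<close>

section \<open>Chebyshev's lower bound for the number of primes\<close>

text \<open>The numbers \<open>1 / (m * (n choose m))\<close> form Leibniz' harmonic triangle: they start with \<open>1 / n\<close> for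
  \<open>m = 1\<close>, and each further one is the difference of its predecessor in the row above and its
  predecessor in the same row. By induction on \<open>m\<close>, multiplication by a common multiple
  of \<open>1, \<dots>, N\<close> therefore makes all of them integral.\<close>

lemma mult_binomial_dvd_common_multiple:
  fixes M N :: nat
  assumes M: "\<And>j. 1 \<le> j \<Longrightarrow> j \<le> N \<Longrightarrow> j dvd M"
  shows "1 \<le> m \<Longrightarrow> m \<le> n \<Longrightarrow> n \<le> N \<Longrightarrow> m * (n choose m) dvd M"
proof (induction m arbitrary: n rule: nat_induct_at_least)
  case base
  then show ?case using M[of n] by simp
next
  case (Suc m)
  from Suc.prems obtain k where n: "n = Suc k" "m \<le> k"
    by (cases n) auto
  have "m * (k choose m) dvd M" "m * (n choose m) dvd M"
    using Suc.IH[of k] Suc.IH[of n] n Suc.prems by simp_all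
  then obtain a b where a: "M = m * (k choose m) * a" and b: "M = m * (n choose m) * b"
    by (elim dvdE)
  have absorb: "Suc m * (n choose Suc m) = n * (k choose m)"
    unfolding n(1) by (rule Suc_times_binomial)
  have comp: "(n - m) * (n choose m) = n * (k choose m)"
    using binomial_absorb_comp[of n m] n by simp
  have "int (n * (k choose m)) * (int a - int b) = int M"
  proof -
    have c: "real n * real (k choose m) = (real n - real m) * real (n choose m)"
    proof -
      have "real (n - m) * real (n choose m) = real n * real (k choose m)"
        using arg_cong[OF comp, of real] by (simp only: of_nat_mult)
      then show ?thesis using n by (simp add: of_nat_diff)
    qed
    have A: "real M = real m * real (k choose m) * real a" by (simp only: a of_nat_mult)
    have B: "real M = real m * real (n choose m) * real b" by (simp only: b of_nat_mult)
    have m0: "real m > 0" using Suc.hyps by simp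
    have "real m * (real n * real (k choose m) * (real a - real b)) = real m * real M"
    proof -
      have "real m * (real n * real (k choose m) * (real a - real b))
          = real n * (real m * real (k choose m) * real a) - real m * real b * (real n * real (k choose m))"
        by (simp add: algebra_simps)
      also have "\<dots> = real n * real M - (real n - real m) * (real m * real (n choose m) * real b)"
        unfolding c A[symmetric] by (simp add: algebra_simps)
      also have "\<dots> = real m * real M" unfolding B[symmetric] by (simp add: algebra_simps)
      finally show ?thesis .
    qed
    then have "real n * real (k choose m) * (real a - real b) = real M" using m0 by (simp only: mult_left_cancel[OF less_imp_neq[OF m0, symmetric]])
    then have "of_int (int (n * (k choose m)) * (int a - int b)) = (of_int (int M) :: real)"
      by (simp only: of_int_mult of_int_diff of_int_of_nat_eq of_nat_mult)
    then show ?thesis by (simp only: of_int_eq_iff)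
  qed
  then have "int (n * (k choose m)) dvd int M" by (rule dvdI[OF sym])
  then show ?case unfolding absorb by (simp only: int_dvd_int_iff)
qed

text \<open>Take the product of the largest powers \<open>p ^ e \<le> N\<close> of the primes \<open>p \<le> N\<close>, which is the least
  common multiple: each prime contributes a factor of at most \<open>N\<close>.\<close>

lemma ex_common_multiple_le_power_card_primes:
  assumes N: "N \<ge> 1"
  shows "\<exists>M::nat. M > 0 \<and> M \<le> N ^ card {p. prime p \<and> p \<le> N} \<and> (\<forall>j. 1 \<le> j \<and> j \<le> N \<longrightarrow> j dvd M)"
proof -
  define P where "P = {p::nat. prime p \<and> p \<le> N}"
  have fin: "finite P" unfolding P_def by simp
  define e where "e p = Max {a. p ^ a \<le> N}" for p :: nat
  have fe: "finite {a. p ^ a \<le> N}" if "p \<in> P" for p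
  proof (rule finite_subset)
    show "{a. p ^ a \<le> N} \<subseteq> {..N}"
    proof
      fix a assume "a \<in> {a. p ^ a \<le> N}"
      moreover have "a < p ^ a"
        using that by (intro power_gt_expt) (auto simp: P_def dest: prime_gt_1_nat)
      ultimately show "a \<in> {..N}" by simp
    qed
  qed simp
  define M where "M = (\<Prod>p\<in>P. p ^ e p)"
  have le: "p ^ e p \<le> N" if "p \<in> P" for p
  proof -
    have "0 \<in> {a. p ^ a \<le> N}" using N by simp
    then show ?thesis using Max_in[OF fe[OF that]] unfolding e_def by blast
  qed
  have "M \<le> (\<Prod>p\<in>P. N)" unfolding M_def using le by (intro prod_mono) auto
  then have M_le: "M \<le> N ^ card P" by simp
  have M0: "M > 0" unfolding M_def P_def by (auto intro!: prod_pos simp: prime_gt_0_nat)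
  have "j dvd M" if j: "1 \<le> j" "j \<le> N" for j
  proof (rule multiplicity_le_imp_dvd)
    show "j \<noteq> 0" using j by simp
    fix p :: nat assume p: "prime p"
    show "multiplicity p j \<le> multiplicity p M"
    proof (cases "p dvd j")
      case False
      then show ?thesis by (simp add: not_dvd_imp_multiplicity_0)
    next
      case True
      then have "p \<le> N" using j dvd_imp_le[of p j] by linarith
      then have pP: "p \<in> P" using p by (simp add: P_def)
      have "p ^ multiplicity p j \<le> N" using j multiplicity_dvd[of p j]
          dvd_imp_le[of "p ^ multiplicity p j" j] by linarith
      then have a: "multiplicity p j \<le> e p" unfolding e_def using fe[OF pP] by (intro Max_ge) auto
      have "p ^ e p dvd M" unfolding M_def using fin pP by (intro dvd_prodI) auto
      then have "e p \<le> multiplicity p M" using M0 p by (intro multiplicity_geI) auto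
      with a show ?thesis by simp
    qed
  qed
  then show ?thesis using M_le M0 unfolding P_def by blast
qed

text \<open>The central binomial coefficient \<open>2 * N choose N\<close> is at least \<open>4 ^ N / (2 * N)\<close>, and \<open>N\<close> times
  it divides the common multiple of the previous lemma; compare exponents of \<open>2\<close> for \<open>2 * N = 2 ^ n\<close>.\<close>

lemma card_primes_le_two_power:
  assumes n: "n \<ge> 1"
  shows "2 ^ (n - 1) \<le> n * card {p::nat. prime p \<and> p \<le> 2 ^ n}"
proof -
  define N :: nat where "N = 2 ^ (n - 1)"
  have N: "N \<ge> 1" "2 * N = 2 ^ n" unfolding N_def using n by (cases n; simp)+
  define c where "c = card {p::nat. prime p \<and> p \<le> 2 ^ n}"
  obtain M :: nat where M: "M > 0" "M \<le> (2 ^ n) ^ c" "\<And>j. 1 \<le> j \<Longrightarrow> j \<le> 2 ^ n \<Longrightarrow> j dvd M"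
    using ex_common_multiple_le_power_card_primes[of "2 ^ n"] unfolding c_def by auto
  have "N * (2 * N choose N) dvd M"
    using mult_binomial_dvd_common_multiple[of "2^n" M N "2*N"] M(3) N by auto
  then have a: "N * (2 * N choose N) \<le> M" using M(1) by (simp add: dvd_imp_le)
  have "4 ^ N / (2 * real N) \<le> real (2 * N choose N)"
    using central_binomial_lower_bound[of N] N by simp
  then have "4 ^ N \<le> 2 * real (N * (2 * N choose N))" using N by (simp add: field_simps)
  then have "(4::real) ^ N \<le> 2 * real ((2 ^ n) ^ c)"
    using a M(2) of_nat_mono[of "N * (2 * N choose N)" "(2 ^ n) ^ c", where 'a = real] by linarith
  then have "(4::nat) ^ N \<le> 2 * (2 ^ n) ^ c"
    unfolding of_nat_le_iff[where 'a = real, symmetric] by simp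
  then have "(2::nat) ^ (2 * N) \<le> 2 ^ (n * c + 1)"
    by (simp add: power_mult)
  then have "2 * N \<le> n * c + 1" by (rule power_le_imp_le_exp[rotated]) simp
  then have "N \<le> n * c" using N by linarith
  then show ?thesis unfolding N_def c_def .
qed

section \<open>Infinitely many choices from finite sets\<close>

text \<open>Koenig's lemma: a condition \<open>G k\<close> looks only at the first \<open>k\<close> choices. Among the partial solutions
  of all lengths, infinitely many agree on the first choice, infinitely many of these on the second,
  and so on, which determines the solution \<open>f\<close>.\<close>

lemma koenig_finite_choices:
  fixes I :: "nat \<Rightarrow> 'a set" and G :: "nat \<Rightarrow> (nat \<Rightarrow> 'a) \<Rightarrow> bool"
  assumes fin: "\<And>i. finite (I i)"
    and local: "\<And>k f g. (\<And>i. i < k \<Longrightarrow> f i = g i) \<Longrightarrow> G k f \<Longrightarrow> G k g"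
    and approx: "\<And>K. \<exists>f. (\<forall>i<K. f i \<in> I i) \<and> (\<forall>k\<le>K. G k f)"
  shows "\<exists>f. (\<forall>i. f i \<in> I i) \<and> (\<forall>k. G k f)"
proof -
  obtain F where F: "\<And>K i. i < K \<Longrightarrow> F K i \<in> I i" "\<And>K k. k \<le> K \<Longrightarrow> G k (F K)"
    using approx by metis
  define P where "P n h \<longleftrightarrow> infinite {K. \<forall>i<n. F K i = h i}" for n and h :: "nat \<Rightarrow> 'a"
  define Q where "Q n h h' \<longleftrightarrow> (\<forall>i<n. h' i = h i)" for n and h h' :: "nat \<Rightarrow> 'a"
  have base: "\<exists>h. P 0 h" by (simp add: P_def)
  have step: "\<exists>h'. P (Suc n) h' \<and> Q n h h'" if "P n h" for n h
  proof -
    let ?S = "{K. \<forall>i<n. F K i = h i}"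
    \<comment> \<open>\<open>F K n\<close> is constrained to \<open>I n\<close> only for \<open>K > n\<close>.\<close>
    have "infinite (?S - {..n})" using that unfolding P_def by simp
    moreover have "(\<lambda>K. F K n) ` (?S - {..n}) \<subseteq> I n" by (auto intro!: F(1))
    then have "finite ((\<lambda>K. F K n) ` (?S - {..n}))" using fin finite_subset by blast
    ultimately obtain K0 where K0: "infinite {K \<in> ?S - {..n}. F K n = F K0 n}"
      using pigeonhole_infinite[of "?S - {..n}" "\<lambda>K. F K n"] by blast
    have "{K \<in> ?S - {..n}. F K n = F K0 n} \<subseteq> {K. \<forall>i<Suc n. F K i = (h(n := F K0 n)) i}"
      by (auto simp: less_Suc_eq)
    then have "P (Suc n) (h(n := F K0 n))" unfolding P_def using K0 finite_subset by blast
    then show ?thesis by (intro exI[of _ "h(n := F K0 n)"]) (simp add: Q_def)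
  qed
  obtain h where h: "\<And>n. P n (h n)" "\<And>n. Q n (h n) (h (Suc n))"
    using dependent_nat_choice[of P Q] base step by metis
  define f where "f i = h (Suc i) i" for i
  have agree: "h n i = f i" if "i < n" for n i
  proof -
    have "Suc i \<le> n" using that by simp
    then show ?thesis
    proof (induction n rule: dec_induct)
      case (step n)
      then show ?case using h(2)[of n] by (simp add: Q_def)
    qed (simp add: f_def)
  qed
  have ex: "\<exists>K\<ge>n. \<forall>i<n. F K i = f i" for n
  proof -
    have "infinite {K. \<forall>i<n. F K i = h n i}" using h(1) unfolding P_def .
    then obtain K where "K \<ge> n" "\<forall>i<n. F K i = h n i"
      unfolding infinite_nat_iff_unbounded_le by blast
    then show ?thesis using agree by auto
  qed
  show ?thesis
  proof (intro exI[of _ f] conjI allI)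
    fix i
    show "f i \<in> I i" using ex[of "Suc i"] F(1)[of i] by (metis Suc_le_eq lessI)
  next
    fix k
    obtain K where "K \<ge> k" "\<forall>i<k. F K i = f i" using ex by blast
    then show "G k f" using local[of k "F K" f] F(2)[of k K] by blast
  qed
qed

section \<open>Sidon sets\<close>

text \<open>Equal sums have equal summands; equivalently, every nonzero integer is a difference in at most one
  way. Both readings are used below.\<close>

definition sidon :: "int set \<Rightarrow> bool" where
  "sidon A \<longleftrightarrow> (\<forall>a\<in>A. \<forall>b\<in>A. \<forall>c\<in>A. \<forall>d\<in>A. a + b = c + d \<longrightarrow> (a = c \<and> b = d) \<or> (a = d \<and> b = c))"

lemma sidonD:
  assumes "sidon A" "a \<in> A" "b \<in> A" "c \<in> A" "d \<in> A" "a + b = c + d"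
  shows "(a = c \<and> b = d) \<or> (a = d \<and> b = c)"
  using assms unfolding sidon_def by blast

lemma sidon_diffD:
  assumes "sidon A" "a \<in> A" "b \<in> A" "c \<in> A" "d \<in> A" "a - b = c - d" "a \<noteq> b"
  shows "a = c \<and> b = d"
  using sidonD[of A a d c b] assms by force

lemma sidon_subset: "sidon A \<Longrightarrow> B \<subseteq> A \<Longrightarrow> sidon B"
  unfolding sidon_def by blast

text \<open>A nontrivial coincidence that involves the new element \<open>y\<close> does not have it on both sides, so the
  side with \<open>y\<close> is either \<open>y + y\<close> or \<open>y + a\<close>.\<close>

lemma sidon_insert:
  assumes A: "sidon A"
    and 1: "\<And>a b. a \<in> A \<Longrightarrow> b \<in> A \<Longrightarrow> y + y \<noteq> a + b"
    and 2: "\<And>a b c. a \<in> A \<Longrightarrow> b \<in> A \<Longrightarrow> c \<in> A \<Longrightarrow> y + a \<noteq> b + c"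
  shows "sidon (insert y A)"
  unfolding sidon_def
proof (intro ballI impI)
  fix a b c d
  assume in4: "a \<in> insert y A" "b \<in> insert y A" "c \<in> insert y A" "d \<in> insert y A" and eq: "a + b = c + d"
  show "(a = c \<and> b = d) \<or> (a = d \<and> b = c)"
  proof (cases "a = y \<or> b = y \<or> c = y \<or> d = y")
    case False
    then show ?thesis using sidonD[OF A, of a b c d] in4 eq by blast
  next
    case True
    have key: False if "b \<in> insert y A" "c \<in> A" "d \<in> A" "y + b = c + d" for b c d
      using that 1[of c d] 2[of b c d] by blast
    show ?thesis
    proof (rule ccontr)
      assume "\<not> ?thesis"
      then have "a \<noteq> c" "a \<noteq> d" "b \<noteq> c" "b \<noteq> d" using eq by auto
      moreover have "b + a = c + d" "c + d = a + b" "d + c = a + b" using eq by linarith+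
      ultimately show False
        using True in4 eq key[of b c d] key[of a c d] key[of d a b] key[of c a b] by blast
    qed
  qed
qed

text \<open>These are the elements whose removal prevents a value \<open>v\<close> from being an element, a sum or a
  difference of elements of \<open>B\<close>. The Sidon property allows only one sum and one difference; from the
  sum the larger summand is chosen, since removed elements are to be large.\<close>

lemma sidon_collisions_card_le:
  assumes B: "sidon B" and v: "v \<noteq> 0"
  shows "finite {b \<in> B. b = v \<or> (\<exists>c\<in>B. c \<le> b \<and> b + c = v) \<or> (\<exists>c\<in>B. b - c = v)} \<and>
    card {b \<in> B. b = v \<or> (\<exists>c\<in>B. c \<le> b \<and> b + c = v) \<or> (\<exists>c\<in>B. b - c = v)} \<le> 3"
    (is "finite ?S \<and> card ?S \<le> 3")
proof -
  let ?S2 = "{b\<in>B. \<exists>c\<in>B. c \<le> b \<and> b + c = v}" and ?S3 = "{b\<in>B. \<exists>c\<in>B. b - c = v}"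
  have 2: "x = y" if "x \<in> ?S2" "y \<in> ?S2" for x y
  proof -
    obtain c c' where "c \<in> B" "c \<le> x" "x + c = v" "c' \<in> B" "c' \<le> y" "y + c' = v" using \<open>x \<in> ?S2\<close> \<open>y \<in> ?S2\<close> by blast
    then show ?thesis using sidonD[OF B, of x c y c'] that by auto
  qed
  have 3: "x = y" if "x \<in> ?S3" "y \<in> ?S3" for x y
  proof -
    obtain c c' where "c \<in> B" "x - c = v" "c' \<in> B" "y - c' = v" using \<open>x \<in> ?S3\<close> \<open>y \<in> ?S3\<close> by blast
    then show ?thesis using sidon_diffD[OF B, of x c y c'] that v by auto
  qed
  have single: "\<exists>b. T \<subseteq> {b}" if "\<And>x y. x \<in> T \<Longrightarrow> y \<in> T \<Longrightarrow> x = y" for T :: "int set"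
  proof (cases "T = {}")
    case False
    then obtain x where "x \<in> T" by blast
    then have "T \<subseteq> {x}" using that by (intro subsetI) simp
    then show ?thesis ..
  qed simp
  obtain b where b: "?S2 \<subseteq> {b}" using single[of ?S2] 2 by meson
  obtain c where c: "?S3 \<subseteq> {c}" using single[of ?S3] 3 by meson
  have "?S \<subseteq> {v} \<union> ?S2 \<union> ?S3" by (intro subsetI) simp
  also have "\<dots> \<subseteq> {v, b, c}" using b c by (intro Un_least) auto
  finally have sub: "?S \<subseteq> {v, b, c}" .
  have "card {v, b, c} \<le> 3" by (simp add: card_insert_if)
  then show ?thesis
    using card_mono[OF _ sub] finite_subset[OF sub] by (meson finite.emptyI finite.insertI le_trans)
qed

section \<open>Extending a Sidon set to a perfect difference set\<close>

text \<open>One stage of the completion. The bound \<open>r\<close> for the number of removed elements does not depend on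
  the size \<open>N\<close> beyond which everything happens: that is what later makes the removed set
  sparse. The coincidences to be excluded are sorted by the coefficient of \<open>x\<close>: two (\<open>ne2\<close>), one
  (\<open>ne1\<close> and \<open>ne3\<close>) or zero (\<open>dd\<close>). That \<open>3\<close> divides the elements of
  \<open>B\<close>, but neither \<open>x\<close> nor \<open>x + d\<close>, is needed for \<open>x + c + a = b + b'\<close> with
  all of \<open>a, b, b'\<close> in \<open>B\<close>, which can have too many solutions to be removed one by one.\<close>

lemma sidon_extend_by_pair:
  fixes B X R :: "int set"
  assumes B: "sidon B" "B \<subseteq> {0<..}" "\<And>b. b \<in> B \<Longrightarrow> 3 dvd b"
    and X: "finite X" "X \<subseteq> {0<..}" and R: "finite R"
    and A: "sidon (B - R \<union> X)"
    and d: "d > 0" "\<And>a b. a \<in> B - R \<union> X \<Longrightarrow> b \<in> B - R \<union> X \<Longrightarrow> a - b \<noteq> d"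
  shows "\<exists>r. \<forall>N. \<exists>x R'. x > N \<and> R \<subseteq> R' \<and> R' - R \<subseteq> B \<inter> {N<..} \<and> finite R' \<and> card R' \<le> r \<and>
    sidon (B - R' \<union> insert x (insert (x + d) X))"
proof -
  define m where "m = Max (insert 0 X)"
  have m: "m \<ge> 0" "\<And>u. u \<in> X \<Longrightarrow> 0 < u \<and> u \<le> m"
    unfolding m_def using X by auto
  define M where "M = 2 * d + 2 * m"
  have M: "M \<ge> 0" unfolding M_def using m d by simp
  define r where "r = card R + 3 * (2 * card {-M..M})"
  show ?thesis
  proof (intro exI[of _ r] allI)
    fix N :: int
    define y where "y = 2 * \<bar>N\<bar> + 6 * M + 1"
    \<comment> \<open>Three consecutive candidates suffice, as at most two of their residues modulo \<open>3\<close> make \<open>x\<close> or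
      \<open>x + d\<close> divisible by \<open>3\<close>.\<close>
    obtain x where x: "x \<ge> y" "\<not> 3 dvd x" "\<not> 3 dvd (x + d)"
    proof -
      have "\<exists>e\<in>{0,1,2}. \<not> 3 dvd (y + e) \<and> \<not> 3 dvd (y + e + d)" by simp presburger
      then obtain e where "e \<in> {0,1,2}" "\<not> 3 dvd (y + e)" "\<not> 3 dvd (y + e + d)" by blast
      then show thesis using that[of "y + e"] by auto
    qed
    have xbig: "x > 2 * N + 6 * M" "x > N" "x > 0" "x > 6 * M" using x(1) M unfolding y_def by auto
    \<comment> \<open>In a coincidence with at most two elements of \<open>B\<close>, the new elements contribute \<open>x\<close> or \<open>2 x\<close>
      and everything else, including the old elements of \<open>X\<close>, at most \<open>M\<close> in absolute value. So
      \<open>V\<close> contains all values that have to be prevented. They exceed \<open>2 N\<close>, hence the larger of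
      the elements of \<open>B\<close> involved exceeds \<open>N\<close>.\<close>
    define V where "V = (\<lambda>e. x + e) ` {-M..M} \<union> (\<lambda>e. 2 * x + e) ` {-M..M}"
    define S where "S v = {b \<in> B. b = v \<or> (\<exists>c\<in>B. c \<le> b \<and> b + c = v) \<or> (\<exists>c\<in>B. b - c = v)}" for v
    define R' where "R' = R \<union> (\<Union>v\<in>V. S v)"
    have V: "v > 2 * N \<and> v > 0" if "v \<in> V" for v using that xbig M unfolding V_def by auto
    have finV: "finite V" unfolding V_def by simp
    have cV: "card V \<le> 2 * card {-M..M}"
    proof -
      have "card V \<le> card ((\<lambda>e. x + e) ` {-M..M}) + card ((\<lambda>e. 2 * x + e) ` {-M..M})"
        unfolding V_def by (rule card_Un_le)
      also have "\<dots> \<le> card {-M..M} + card {-M..M}"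
        by (intro add_mono card_image_le) auto
      finally show ?thesis by simp
    qed
    have S: "finite (S v) \<and> card (S v) \<le> 3" if "v \<in> V" for v
      unfolding S_def using sidon_collisions_card_le[OF B(1), of v] V[OF that] by simp
    have finR': "finite R'" unfolding R'_def using R finV S by auto
    have "card (\<Union>v\<in>V. S v) \<le> (\<Sum>v\<in>V. card (S v))" using finV by (rule card_UN_le)
    also have "\<dots> \<le> (\<Sum>v\<in>V. 3)" using S by (intro sum_mono) auto
    finally have "card (\<Union>v\<in>V. S v) \<le> 3 * (2 * card {-M..M})" using cV by simp
    then have cR': "card R' \<le> r" unfolding R'_def r_def using card_Un_le le_trans by (meson add_left_mono)
    have new: "R' - R \<subseteq> B \<inter> {N<..}"
    proof
      fix b assume b: "b \<in> R' - R"
      then obtain v where v: "v \<in> V" "b \<in> S v" unfolding R'_def by auto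
      then have "b \<in> B" by (simp add: S_def)
      moreover have "b > N"
        using v(2) V[OF v(1)] B(2) unfolding S_def by fastforce
      ultimately show "b \<in> B \<inter> {N<..}" by simp
    qed
    define A' where "A' = B - R' \<union> X"
    have RR: "R \<subseteq> R'" by (simp add: R'_def)
    have sA': "sidon A'" unfolding A'_def using RR by (intro sidon_subset[OF A]) auto
    have far: "b \<noteq> v" "b + c \<noteq> v" "b - c \<noteq> v" if "b \<in> B - R'" "c \<in> B - R'" "v \<in> V" for b c v
    proof -
      have nb: "b \<notin> S v" "c \<notin> S v" using that unfolding R'_def by auto
      show "b \<noteq> v" "b - c \<noteq> v" using nb(1) that unfolding S_def by auto
      show "b + c \<noteq> v" using nb that linear[of b c] unfolding S_def by (auto simp: add.commute)
    qed
    have inV1: "x + e \<in> V" "2 * x + e \<in> V" if "-M \<le> e" "e \<le> M" for e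
      using that unfolding V_def by auto
    have AE: "a \<in> B - R' \<or> (a \<in> X \<and> 0 < a \<and> a \<le> m)" if "a \<in> A'" for a
      using that m unfolding A'_def by blast
    have pos: "0 < a" if "a \<in> A'" for a
      using AE[OF that] B(2) by auto
    have ne1: "a \<noteq> x + c" if "a \<in> A'" "-d \<le> c" "c \<le> 2 * d" for a c
      using AE[OF that(1)] far(1)[of a a "x + c"] inV1(1)[of c] that xbig m(1) d(1) unfolding M_def by auto
    have ne2: "a + b \<noteq> 2 * x + c" if "a \<in> A'" "b \<in> A'" "0 \<le> c" "c \<le> 2 * d" for a b c
    proof -
      have *: "a + b \<noteq> 2 * x + c" if "a \<in> B - R'" "b \<in> X" "0 < b" "b \<le> m" for a b
        using far(1)[of a a "2 * x + (c - b)"] inV1(2)[of "c - b"] that \<open>0 \<le> c\<close> \<open>c \<le> 2 * d\<close> m(1) d(1)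
        unfolding M_def by auto
      show ?thesis
        using AE[OF that(1)] AE[OF that(2)] far(2)[of a b "2 * x + c"] inV1(2)[of c] *[of a b] *[of b a]
          that(3,4) xbig m(1) d(1) unfolding M_def by (auto simp: add.commute)
    qed
    have ne3: "x + c + a \<noteq> b + b'" if "a \<in> A'" "b \<in> A'" "b' \<in> A'" "c \<in> {0, d}" for a b b' c
    proof
      assume eq: "x + c + a = b + b'"
      have c: "0 \<le> c" "c \<le> d" "\<not> 3 dvd (x + c)" using that(4) d x by auto
      note mem = that(1-3)
      have aux: False if "a \<in> A'" "b \<in> B - R'" "b' \<in> X" "0 < b'" "b' \<le> m" "x + c + a = b + b'" for a b b'
        using AE[OF that(1)]
      proof
        assume "a \<in> B - R'"
        then show False
          using far(3)[of b a "x + (c - b')"] inV1(1)[of "c - b'"] that c m(1) d(1) unfolding M_def by auto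
      next
        assume "a \<in> X \<and> 0 < a \<and> a \<le> m"
        then show False
          using far(1)[of b b "x + (c + a - b')"] inV1(1)[of "c + a - b'"] that c m(1) d(1) unfolding M_def by auto
      qed
      consider (BB) "b \<in> B - R'" "b' \<in> B - R'" | (BX) "b \<in> B - R'" "b' \<in> X" "0 < b'" "b' \<le> m"
        | (XB) "b' \<in> B - R'" "b \<in> X" "0 < b" "b \<le> m" | (XX) "b \<le> m" "b' \<le> m"
        using AE[OF mem(2)] AE[OF mem(3)] by blast
      then show False
      proof cases
        case BB
        from AE[OF mem(1)] show False
        proof
          assume "a \<in> B - R'"
          then have "3 dvd (b + b' - a)" using BB B(3) by (intro dvd_diff dvd_add) auto
          moreover have "b + b' - a = x + c" using eq by simp
          ultimately show False using c by simp
        next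
          assume "a \<in> X \<and> 0 < a \<and> a \<le> m"
          then show False
            using far(2)[of b b' "x + (c + a)"] BB inV1(1)[of "c + a"] eq c m(1) d(1) unfolding M_def by auto
        qed
      next
        case BX
        then show False using aux[OF mem(1), of b b'] eq by simp
      next
        case XB
        then show False using aux[OF mem(1), of b' b] eq by simp
      next
        case XX
        then show False using eq pos[OF mem(1)] c xbig m(1) d(1) unfolding M_def by auto
      qed
    qed
    \<comment> \<open>The coincidences in which \<open>x\<close> cancels are excluded because \<open>d\<close> is a missing difference.\<close>
    have dd: "a - b \<noteq> d" if "a \<in> A'" "b \<in> A'" for a b
      using d(2)[of a b] that RR unfolding A'_def by blast
    have s1: "sidon (insert (x + d) A')"
      using sA'
    proof (rule sidon_insert)
      fix a b assume "a \<in> A'" "b \<in> A'"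
      then show "x + d + (x + d) \<noteq> a + b" using ne2[of a b "2 * d"] d(1) by simp
    next
      fix a b c assume "a \<in> A'" "b \<in> A'" "c \<in> A'"
      then show "x + d + a \<noteq> b + c" using ne3[of a b c d] by simp
    qed
    have "sidon (insert x (insert (x + d) A'))"
      using s1
    proof (rule sidon_insert)
      fix a b assume "a \<in> insert (x + d) A'" "b \<in> insert (x + d) A'"
      then show "x + x \<noteq> a + b"
        using ne2[of a b 0] ne1[of a "-d"] ne1[of b "-d"] d(1) by (elim insertE) simp_all
    next
      fix a b c assume "a \<in> insert (x + d) A'" "b \<in> insert (x + d) A'" "c \<in> insert (x + d) A'"
      then show "x + a \<noteq> b + c"
        using ne3[of a b c 0] ne1[of a d] ne1[of b 0] ne1[of c 0] ne2[of b c d] dd[of a b] dd[of a c]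
          ne1[of a "2*d"] d(1) by (elim insertE) simp_all
    qed
    then show "\<exists>x R'. x > N \<and> R \<subseteq> R' \<and> R' - R \<subseteq> B \<inter> {N<..} \<and> finite R' \<and> card R' \<le> r \<and>
        sidon (B - R' \<union> insert x (insert (x + d) X))"
      using xbig RR new finR' cR' unfolding A'_def by (intro exI[of _ x] exI[of _ R']) auto
  qed
qed

text \<open>At most \<open>log 2 (y + 1)\<close> elements up to \<open>y\<close>, written with a power of two to stay in the integers.
  The notion is meant for sets of positive integers, which have finite intersections with \<open>{..y}\<close>.\<close>

definition log_sparse :: "int set \<Rightarrow> bool" where
  "log_sparse R \<longleftrightarrow> (\<forall>y\<ge>0. 2 ^ card (R \<inter> {..y}) \<le> y + 1)"

lemma log_sparse_Un_far:
  assumes R: "log_sparse R" "R \<subseteq> R'" and R': "finite R'" "R' - R \<subseteq> {N<..}" "2 ^ card R' \<le> N"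
  shows "log_sparse R'"
  unfolding log_sparse_def
proof (intro allI impI)
  fix y :: int assume y: "y \<ge> 0"
  show "2 ^ card (R' \<inter> {..y}) \<le> y + 1"
  proof (cases "y \<le> N")
    case True
    have "R' \<inter> {..y} = R \<inter> {..y}"
    proof
      show "R \<inter> {..y} \<subseteq> R' \<inter> {..y}" using R(2) by (rule Int_mono) simp
      show "R' \<inter> {..y} \<subseteq> R \<inter> {..y}"
      proof
        fix z assume z: "z \<in> R' \<inter> {..y}"
        have "z \<notin> R' - R"
        proof
          assume "z \<in> R' - R"
          then have "z \<in> {N<..}" by (rule subsetD[OF R'(2)])
          then show False using True z by simp
        qed
        then show "z \<in> R \<inter> {..y}" using z by simp
      qed
    qed
    then show ?thesis using R(1) y unfolding log_sparse_def by simp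
  next
    case False
    have "card (R' \<inter> {..y}) \<le> card R'" using R'(1) by (intro card_mono) auto
    then have "(2::int) ^ card (R' \<inter> {..y}) \<le> 2 ^ card R'" by (intro power_increasing) auto
    then show ?thesis using R'(3) False by linarith
  qed
qed

lemma perfect_difference_setI:
  assumes A: "sidon A" and rep: "\<And>d. d > 0 \<Longrightarrow> \<exists>a\<in>A. \<exists>b\<in>A. a - b = d"
  shows "perfect_difference_set A"
  unfolding perfect_difference_set_def
proof (intro allI impI)
  fix u :: int assume u: "u \<noteq> 0"
  have "\<exists>a\<in>A. \<exists>b\<in>A. a - b = u"
  proof (cases "u > 0")
    case True then show ?thesis using rep by blast
  next
    case False
    then obtain a b where "a \<in> A" "b \<in> A" "a - b = - u" using rep[of "-u"] u by auto
    then show ?thesis by (intro bexI[of _ b] bexI[of _ a]) auto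
  qed
  then obtain a b where ab: "a \<in> A" "b \<in> A" "a - b = u" by blast
  have uniq: "c = a \<and> e = b" if "c \<in> A" "e \<in> A" "u = c - e" for c e
    using sidon_diffD[OF A, of a b c e] ab u that by auto
  have "{(a, a'). a \<in> A \<and> a' \<in> A \<and> u = a - a'} = {(a, b)}"
  proof (intro equalityI subsetI)
    fix p assume "p \<in> {(a, a'). a \<in> A \<and> a' \<in> A \<and> u = a - a'}"
    then show "p \<in> {(a, b)}" using uniq[of "fst p" "snd p"] by (cases p) simp
  qed (use ab in simp)
  then show "diff_count A u = 1" unfolding diff_count_def by simp
qed

text \<open>Stage \<open>n + 1\<close> makes sure that \<open>n + 1\<close> is a difference, either by recording a representation that
  exists already or by \<open>sidon_extend_by_pair\<close>. All later removals are larger than the elements of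
  the representations recorded so far, so these survive in the limit (\<open>late\<close>); the Sidon property
  survives since it involves only four elements at a time.\<close>

lemma sidon_extends_to_perfect_difference_set:
  fixes B :: "int set"
  assumes B: "sidon B" "B \<subseteq> {0<..}" "\<And>b. b \<in> B \<Longrightarrow> 3 dvd b"
  shows "\<exists>A R. A \<subseteq> {0<..} \<and> perfect_difference_set A \<and> B - R \<subseteq> A \<and> R \<subseteq> {0<..} \<and> log_sparse R"
proof -
  define P :: "nat \<Rightarrow> int set \<times> int set \<times> int \<Rightarrow> bool" where
    "P n = (\<lambda>(X, R, N). finite X \<and> X \<subseteq> {0<..} \<and> finite R \<and> R \<subseteq> B \<and> sidon (B - R \<union> X) \<and> log_sparse R \<and>
      (\<forall>d\<in>{0<..int n}. \<exists>a\<in>B - R \<union> X. \<exists>b\<in>B - R \<union> X. a \<le> N \<and> b \<le> N \<and> a - b = d))" for n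
  define Q :: "nat \<Rightarrow> int set \<times> int set \<times> int \<Rightarrow> int set \<times> int set \<times> int \<Rightarrow> bool" where
    "Q n = (\<lambda>(X, R, N) (X', R', N'). X \<subseteq> X' \<and> R \<subseteq> R' \<and> N \<le> N' \<and> R' - R \<subseteq> {N<..})" for n
  have base: "\<exists>s. P 0 s"
    unfolding P_def using B by (intro exI[of _ "({}, {}, 0)"]) (auto simp: log_sparse_def)
  \<comment> \<open>A state consists of the added elements, the removed elements, and a bound for the elements that
    are needed to represent the differences up to \<open>n\<close>. Later removals stay above that bound.\<close>
  have step: "\<exists>s'. P (Suc n) s' \<and> Q n s s'" if "P n s" for n s
  proof -
    obtain X R N where s: "s = (X, R, N)" by (cases s)
    have X: "finite X" "X \<subseteq> {0<..}" and R: "finite R" "R \<subseteq> B" "log_sparse R" and A: "sidon (B - R \<union> X)"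
      and rep: "\<And>d. d \<in> {0<..int n} \<Longrightarrow> \<exists>a\<in>B - R \<union> X. \<exists>b\<in>B - R \<union> X. a \<le> N \<and> b \<le> N \<and> a - b = d"
      using that unfolding s P_def by auto
    define d where "d = int (Suc n)"
    have d: "d > 0" by (simp add: d_def)
    have range: "{0<..d} = insert d {0<..int n}" unfolding d_def by auto
    show ?thesis
    proof (cases "\<exists>a\<in>B - R \<union> X. \<exists>b\<in>B - R \<union> X. a - b = d")
      case True
      then obtain a b where ab: "a \<in> B - R \<union> X" "b \<in> B - R \<union> X" "a - b = d" by blast
      define N' where "N' = max N (max a b)"
      have le: "N \<le> N'" "a \<le> N'" "b \<le> N'" by (auto simp: N'_def)
      have "\<exists>a\<in>B - R \<union> X. \<exists>b\<in>B - R \<union> X. a \<le> N' \<and> b \<le> N' \<and> a - b = e" if "e \<in> {0<..d}" for e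
      proof (cases "e = d")
        case True then show ?thesis using ab le by blast
      next
        case False
        then have "e \<in> {0<..int n}" using that range by auto
        then show ?thesis using rep le(1) by (meson order_trans)
      qed
      then have "P (Suc n) (X, R, N')" unfolding P_def using X R A by (simp add: d_def)
      moreover have "Q n s (X, R, N')" unfolding Q_def s using le by simp
      ultimately show ?thesis by blast
    next
      case False
      then obtain r where r: "\<And>N. \<exists>x R'. x > N \<and> R \<subseteq> R' \<and> R' - R \<subseteq> B \<inter> {N<..} \<and> finite R' \<and> card R' \<le> r \<and>
          sidon (B - R' \<union> insert x (insert (x + d) X))"
        using sidon_extend_by_pair[OF B X R(1) A d] by blast
      \<comment> \<open>The number \<open>r\<close> of removals is known before their position is chosen: starting at \<open>2 ^ r\<close>
        keeps the removed set sparse.\<close>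
      define N0 where "N0 = max 1 (max N (2 ^ r))"
      obtain x R' where x: "x > N0" and R': "R \<subseteq> R'" "R' - R \<subseteq> B \<inter> {N0<..}" "finite R'" "card R' \<le> r"
        and S: "sidon (B - R' \<union> insert x (insert (x + d) X))"
        using r[of N0] by blast
      define X' where "X' = insert x (insert (x + d) X)"
      have N0: "N \<le> N0" "1 \<le> N0" "2 ^ r \<le> N0" by (auto simp: N0_def)
      have "(2::int) ^ card R' \<le> 2 ^ r" using R'(4) by (intro power_increasing) auto
      then have "2 ^ card R' \<le> N0" using N0(3) by linarith
      then have "log_sparse R'" using R' R(3) by (intro log_sparse_Un_far[of R R' N0]) auto
      moreover have "\<exists>a\<in>B - R' \<union> X'. \<exists>b\<in>B - R' \<union> X'. a \<le> x + d \<and> b \<le> x + d \<and> a - b = e" if "e \<in> {0<..d}" for e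
      proof (cases "e = d")
        case True
        then show ?thesis using d by (intro bexI[of _ "x + d"] bexI[of _ x]) (auto simp: X'_def)
      next
        case False
        then have "e \<in> {0<..int n}" using that range by auto
        then obtain a b where ab: "a \<in> B - R \<union> X" "b \<in> B - R \<union> X" "a \<le> N" "b \<le> N" "a - b = e"
          using rep by blast
        have "c \<in> B - R' \<union> X'" if "c \<in> B - R \<union> X" "c \<le> N" for c
        proof -
          have "c \<notin> R' - R" using that(2) R'(2) N0(1) by auto
          then show ?thesis using that(1) unfolding X'_def by blast
        qed
        then have "a \<in> B - R' \<union> X'" "b \<in> B - R' \<union> X'" using ab by blast+
        moreover have "a \<le> x + d" "b \<le> x + d" using ab x d N0(1) by linarith+
        ultimately show ?thesis using ab(5) by blast
      qed
      moreover have "R' \<subseteq> B" using R' R(2) by blast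
      moreover have "X' \<subseteq> {0<..}" using x d N0 X unfolding X'_def by auto
      ultimately have "P (Suc n) (X', R', x + d)"
        unfolding P_def using X R'(3) S by (simp add: d_def X'_def)
      moreover have "Q n s (X', R', x + d)"
        unfolding Q_def s X'_def using R' x d N0(1) by auto
      ultimately show ?thesis by blast
    qed
  qed
  obtain f where f: "\<And>n. P n (f n)" "\<And>n. Q n (f n) (f (Suc n))"
    using dependent_nat_choice[of P Q] base step by metis
  define X where "X n = fst (f n)" for n
  define R where "R n = fst (snd (f n))" for n
  define N where "N n = snd (snd (f n))" for n
  have fn: "f n = (X n, R n, N n)" for n by (simp add: X_def R_def N_def)
  have p: "X n \<subseteq> {0<..}" "R n \<subseteq> B" "sidon (B - R n \<union> X n)" "log_sparse (R n)" "finite (R n)"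
    and rep: "\<And>d. d \<in> {0<..int n} \<Longrightarrow> \<exists>a\<in>B - R n \<union> X n. \<exists>b\<in>B - R n \<union> X n. a \<le> N n \<and> b \<le> N n \<and> a - b = d" for n
    using f(1)[of n] unfolding fn P_def by auto
  have q: "X n \<subseteq> X (Suc n)" "R n \<subseteq> R (Suc n)" "N n \<le> N (Suc n)" "R (Suc n) - R n \<subseteq> {N n<..}" for n
    using f(2)[of n] unfolding fn Q_def by auto
  have mono: "X m \<subseteq> X n" "R m \<subseteq> R n" "N m \<le> N n" if "m \<le> n" for m n
    using lift_Suc_mono_le[of X, OF q(1) that] lift_Suc_mono_le[of R, OF q(2) that]
      lift_Suc_mono_le[of N, OF q(3) that] by auto
  have late: "b \<in> R m" if "b \<in> R n" "b \<le> N m" "m \<le> n" for b m n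
    using that(3,1)
  proof (induction n rule: dec_induct)
    case (step n)
    then have "b \<le> N n" using mono(3)[of m n] that(2) by simp
    then have "b \<notin> R (Suc n) - R n" using q(4)[of n] by auto
    then have "b \<in> R n" using step.prems by blast
    then show ?case by (rule step.IH)
  qed
  define RR where "RR = (\<Union>n. R n)"
  define A where "A = B - RR \<union> (\<Union>n. X n)"
  have "sidon A"
  proof -
    have *: "\<exists>n. \<forall>m\<ge>n. a \<in> B - R m \<union> X m" if aA: "a \<in> A" for a
    proof (cases "a \<in> B - RR")
      case True
      then show ?thesis unfolding RR_def by blast
    next
      case False
      then obtain n where "a \<in> X n" using aA unfolding A_def by blast
      then have "a \<in> X m" if "m \<ge> n" for m using mono(1)[OF that] by blast
      then show ?thesis by (intro exI[of _ n]) simp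
    qed
    show ?thesis unfolding sidon_def
    proof (intro ballI impI)
      fix a b c d assume mem: "a \<in> A" "b \<in> A" "c \<in> A" "d \<in> A" and eq: "a + b = c + d"
      obtain n1 where n1: "\<forall>m\<ge>n1. a \<in> B - R m \<union> X m" using *[OF mem(1)] by (rule exE)
      obtain n2 where n2: "\<forall>m\<ge>n2. b \<in> B - R m \<union> X m" using *[OF mem(2)] by (rule exE)
      obtain n3 where n3: "\<forall>m\<ge>n3. c \<in> B - R m \<union> X m" using *[OF mem(3)] by (rule exE)
      obtain n4 where n4: "\<forall>m\<ge>n4. d \<in> B - R m \<union> X m" using *[OF mem(4)] by (rule exE)
      define m where "m = n1 + n2 + n3 + n4"
      have "a \<in> B - R m \<union> X m" "b \<in> B - R m \<union> X m" "c \<in> B - R m \<union> X m" "d \<in> B - R m \<union> X m"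
        using n1 n2 n3 n4 by (simp_all only: m_def le_add1 le_add2 trans_le_add1 trans_le_add2)
      then show "(a = c \<and> b = d) \<or> (a = d \<and> b = c)" using sidonD[OF p(3)[of m]] eq by simp
    qed
  qed
  moreover have "\<exists>a\<in>A. \<exists>b\<in>A. a - b = d" if d: "d > 0" for d
  proof -
    define n where "n = nat d"
    obtain a b where ab: "a \<in> B - R n \<union> X n" "b \<in> B - R n \<union> X n" "a \<le> N n" "b \<le> N n" "a - b = d"
      using rep[of d n] d unfolding n_def by (auto simp del: Un_iff Diff_iff)
    have "c \<in> A" if c: "c \<in> B - R n \<union> X n" "c \<le> N n" for c
    proof (cases "c \<in> X n")
      case True then show ?thesis unfolding A_def by blast
    next
      case False
      have "c \<notin> R m" for m
        using late[of c m n] mono(2)[of m n] c False by (cases "n \<le> m") auto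
      then show ?thesis using c False unfolding A_def RR_def by blast
    qed
    then show ?thesis using ab by (intro bexI[of _ a] bexI[of _ b]) auto
  qed
  ultimately have "perfect_difference_set A" by (intro perfect_difference_setI) auto
  moreover have "A \<subseteq> {0<..}" using p(1) B(2) unfolding A_def by blast
  moreover have "B - RR \<subseteq> A" by (simp add: A_def)
  moreover have RR0: "RR \<subseteq> {0<..}" using p(2) B(2) unfolding RR_def by blast
  moreover have "log_sparse RR"
    unfolding log_sparse_def
  proof (intro allI impI)
    fix y :: int assume y: "y \<ge> 0"
    \<comment> \<open>Only finitely many elements lie below \<open>y\<close>, so one stage already contains them all.\<close>
    have fin: "finite (RR \<inter> {..y})"
      using finite_subset[of "RR \<inter> {..y}" "{0<..y}"] RR0 by fastforce
    obtain g where g: "\<And>x. x \<in> RR \<inter> {..y} \<Longrightarrow> x \<in> R (g x)"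
      unfolding RR_def by (metis IntD1 UN_E)
    define n where "n = (\<Sum>x\<in>RR \<inter> {..y}. g x)"
    have "x \<in> R n" if "x \<in> RR \<inter> {..y}" for x
    proof -
      have "g x \<le> n" unfolding n_def using fin that by (intro member_le_sum) auto
      then show ?thesis using g[OF that] mono(2) by blast
    qed
    then have "RR \<inter> {..y} \<subseteq> R n \<inter> {..y}" by blast
    then have "card (RR \<inter> {..y}) \<le> card (R n \<inter> {..y})" using p(5) by (intro card_mono) auto
    then have "(2::int) ^ card (RR \<inter> {..y}) \<le> 2 ^ card (R n \<inter> {..y})" by (intro power_increasing) auto
    also have "\<dots> \<le> y + 1" using p(4)[of n] y unfolding log_sparse_def by blast
    finally show "2 ^ card (RR \<inter> {..y}) \<le> y + 1" .
  qed
  ultimately show ?thesis by blast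
qed

section \<open>Discrete logarithms, mixed radix expansions and prime divisors\<close>

text \<open>The logarithm is used only through the fact that the sum of two logarithms, as integers and not
  merely modulo \<open>q - 1\<close>, determines the product modulo \<open>q\<close>. So reduced representatives may be
  added freely.\<close>

lemma ex_discrete_log:
  fixes q :: nat
  assumes q: "prime q"
  shows "\<exists>l :: nat \<Rightarrow> nat. (\<forall>n. coprime n q \<longrightarrow> l n < q) \<and>
    (\<forall>a b c d. coprime a q \<longrightarrow> coprime b q \<longrightarrow> coprime c q \<longrightarrow> coprime d q \<longrightarrow>
      l a + l b = l c + l d \<longrightarrow> [a * b = c * d] (mod q))"
proof -
  have q1: "q > 1" using q by (rule prime_gt_1_nat)
  obtain g where g: "residue_primroot q g"
    using prime_primitive_root_exists[of q] q q1 by auto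
  have ex: "\<exists>i<q. [g ^ i = n] (mod q)" if n: "coprime n q" for n
  proof -
    have "\<not> q dvd n" using n q by (metis coprime_common_divisor dvd_refl not_prime_unit)
    then have "n mod q \<in> totatives q"
      using n q1 by (auto simp: totatives_def mod_greater_zero_iff_not_dvd intro: less_imp_le)
    then have "n mod q \<in> (\<lambda>i. g ^ i mod q) ` {..<totient q}"
      using residue_primroot_is_generator[OF q1 g] by (simp add: bij_betw_def)
    then obtain i where i: "i < totient q" "n mod q = g ^ i mod q" by auto
    have "[g ^ i mod q = n mod q] (mod q)" unfolding i(2) by (rule cong_refl)
    then have "[g ^ i = n] (mod q)" by simp
    moreover have "totient q \<le> q" by (rule totient_le)
    ultimately show ?thesis using i(1) by (intro exI[of _ i]) simp
  qed
  then obtain l where l: "\<And>n. coprime n q \<Longrightarrow> l n < q \<and> [g ^ l n = n] (mod q)" by metis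
  have "[a * b = c * d] (mod q)"
    if "coprime a q" "coprime b q" "coprime c q" "coprime d q" "l a + l b = l c + l d" for a b c d
  proof -
    have "[a * b = g ^ (l a + l b)] (mod q)"
      unfolding power_add by (intro cong_mult cong_sym[OF conjunct2[OF l]] that)
    also have "[g ^ (l a + l b) = c * d] (mod q)"
      unfolding that(5) power_add by (intro cong_mult conjunct2[OF l] that)
    finally show ?thesis .
  qed
  then show ?thesis using l by (intro exI[of _ l]) blast
qed

lemma mixed_radix_less:
  fixes s b :: "nat \<Rightarrow> nat"
  assumes "\<And>i. i < K \<Longrightarrow> s i < b i"
  shows "(\<Sum>i<K. s i * (\<Prod>j<i. b j)) < (\<Prod>j<K. b j)"
  using assms
proof (induction K)
  case (Suc K)
  let ?W = "\<Prod>j<K. b j"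
  have "(\<Sum>i<Suc K. s i * (\<Prod>j<i. b j)) < ?W + s K * ?W" using Suc by simp
  also have "\<dots> = Suc (s K) * ?W" by simp
  also have "\<dots> \<le> b K * ?W" using Suc.prems[of K] by (intro mult_right_mono) auto
  finally show ?case by (simp add: mult.commute)
qed simp

lemma mixed_radix_unique:
  fixes s s' b :: "nat \<Rightarrow> nat"
  assumes "\<And>i. i < K \<Longrightarrow> s i < b i" "\<And>i. i < K \<Longrightarrow> s' i < b i"
    and "(\<Sum>i<K. s i * (\<Prod>j<i. b j)) = (\<Sum>i<K. s' i * (\<Prod>j<i. b j))"
  shows "i < K \<Longrightarrow> s i = s' i"
  using assms
proof (induction K)
  case (Suc K)
  let ?W = "\<Prod>j<K. b j" and ?S = "\<lambda>s. \<Sum>i<K. s i * (\<Prod>j<i. b j)"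
  have less: "?S s < ?W" "?S s' < ?W" using Suc.prems by (intro mixed_radix_less; simp)+
  then have W: "?W \<noteq> 0" by linarith
  have eq: "?S s + s K * ?W = ?S s' + s' K * ?W" using Suc.prems(4) by simp
  have "s K = (?S s + s K * ?W) div ?W" using less W by simp
  also have "\<dots> = s' K" unfolding eq using less W by simp
  finally have K: "s K = s' K" .
  then have "?S s = ?S s'" using eq by simp
  then show ?case using Suc.IH Suc.prems K by (cases "i = K") auto
qed simp

lemma prod_primes_dvd:
  fixes n :: nat
  assumes "finite I" "inj_on q I" "\<And>i. i \<in> I \<Longrightarrow> prime (q i) \<and> q i dvd n"
  shows "(\<Prod>i\<in>I. q i) dvd n"
  using assms
proof (induction I rule: finite_induct)
  case (insert x I)
  have "coprime (q x) (\<Prod>i\<in>I. q i)"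
  proof (rule prod_coprime_right)
    fix i assume i: "i \<in> I"
    then have "q x \<noteq> q i" using insert.prems(1) insert.hyps by (auto simp: inj_on_def)
    then show "coprime (q x) (q i)" using insert.prems(2)[of x] insert.prems(2)[of i] i
      by (intro primes_coprime) auto
  qed
  then have "q x * (\<Prod>i\<in>I. q i) dvd n"
    using insert by (intro divides_mult) auto
  then show ?case using insert.hyps by simp
qed simp

text \<open>The crude bound \<open>log 2 n\<close> for the number of prime divisors suffices: for the numbers in question it
  is polynomial in \<open>k\<close>, and a product of \<open>k\<close> such bounds is \<open>2 ^ O(k\<^sup>2)\<close>.\<close>

lemma two_power_card_prime_divisors_le:
  fixes n :: nat
  assumes "finite T" "n > 0" "\<And>p. p \<in> T \<Longrightarrow> prime p \<and> p dvd n"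
  shows "2 ^ card T \<le> n"
proof -
  have "2 ^ card T = (\<Prod>p\<in>T. 2::nat)" by simp
  also have "\<dots> \<le> (\<Prod>p\<in>T. p)" using assms(3) by (intro prod_mono) (auto dest: prime_ge_2_nat)
  also have "\<dots> \<le> n" using assms(2) prod_primes_dvd[of T "\<lambda>p. p" n] assms(1,3) by (intro dvd_imp_le) auto
  finally show ?thesis .
qed

section \<open>Prime moduli of prescribed size\<close>

text \<open>The candidates for the modulus \<open>q i\<close>. Exponents that grow quadratically permit disjoint
  windows which are so wide that the weak form of Chebyshev's bound fills them. At the same time
  the exponents sum up to \<open>4/3 k\<^sup>3 + O(k\<^sup>2)\<close> whether the lower or
  the upper ends are used, so the width of the windows is of lower order.\<close>

definition window :: "nat \<Rightarrow> nat set" where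
  "window i = {q. prime q \<and> 2 ^ (4 * i * (i + 1)) < q \<and> q \<le> 2 ^ (4 * (i + 1)\<^sup>2)}"

lemma finite_window: "finite (window i)"
  by (rule finite_subset[of _ "{..2 ^ (4 * (i + 1)\<^sup>2)}"]) (auto simp: window_def)

text \<open>With \<open>n\<close> and \<open>m\<close> the exponents of the upper and lower end, the primes up to \<open>2 ^ n\<close> outside the
  window number at most \<open>2 ^ m\<close>, while \<open>n - m = 4 * (i + 1)\<close> makes \<open>2 ^ n / (2 * n)\<close> at least
  twice that.\<close>

lemma card_window: "2 ^ (4 * i * (i + 1)) \<le> card (window i)"
proof (rule ccontr)
  define j where "j = i + 1"
  define n where "n = 4 * j\<^sup>2"
  define m where "m = 4 * i * (i + 1)"
  have nm: "n = m + 4 * j" unfolding n_def m_def j_def by (simp add: power2_eq_square algebra_simps)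
  have j: "j \<ge> 1" by (simp add: j_def)
  assume "\<not> 2 ^ (4 * i * (i + 1)) \<le> card (window i)"
  then have less: "card (window i) + 2 ^ m < 2 ^ (m + 1)" by (simp add: m_def)
  have "{p. prime p \<and> p \<le> 2 ^ n} \<subseteq> window i \<union> {1..2 ^ m}"
    unfolding window_def n_def m_def j_def by (auto simp: not_less Suc_leI prime_gt_0_nat)
  then have "card {p::nat. prime p \<and> p \<le> 2 ^ n} \<le> card (window i \<union> {1..2 ^ m})"
    by (intro card_mono) (simp_all add: finite_window)
  also have "\<dots> \<le> card (window i) + 2 ^ m"
    using card_Un_le[of "window i" "{1..2 ^ m}"] by simp
  finally have "card {p::nat. prime p \<and> p \<le> 2 ^ n} < 2 ^ (m + 1)" using less by simp
  moreover have n1: "n \<ge> 1" using j by (simp add: n_def)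
  ultimately have "2 ^ (n - 1) < n * 2 ^ (m + 1)"
    using card_primes_le_two_power[OF n1] by (meson le_less_trans mult_less_mono2 less_le_trans zero_less_one)
  moreover have "n * 2 ^ (m + 1) \<le> 2 ^ (n - 1)"
  proof -
    have "2 * j \<le> 2 ^ j" using j
    proof (induction j rule: nat_induct_at_least)
      case (Suc k)
      then show ?case by (cases k) (auto simp: algebra_simps)
    qed simp
    then have "(2 * j)\<^sup>2 \<le> (2 ^ j)\<^sup>2" by (rule power_mono) simp
    then have a: "n \<le> 2 ^ (2 * j)" unfolding n_def by (simp add: power_mult power2_eq_square power_mult_distrib flip: power_add mult_2)
    have "n * 2 ^ (m + 1) \<le> 2 ^ (2 * j) * 2 ^ (m + 1)" using a by (rule mult_right_mono) simp
    also have "\<dots> = 2 ^ (2 * j + (m + 1))" by (simp add: power_add)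
    also have "\<dots> \<le> 2 ^ (n - 1)" using j nm by (intro power_increasing) auto
    finally show ?thesis .
  qed
  ultimately show False by simp
qed

lemma window_mono:
  assumes "a \<in> window i" "b \<in> window j" "i < j"
  shows "a < b"
proof -
  have "a \<le> 2 ^ (4 * (i + 1)\<^sup>2)" "2 ^ (4 * j * (j + 1)) < b" using assms by (auto simp: window_def)
  moreover have "4 * (i + 1)\<^sup>2 \<le> 4 * j * (j + 1)"
  proof -
    have "(i + 1) * (i + 1) \<le> j * (j + 1)" using assms(3) by (intro mult_mono) auto
    then show ?thesis by (simp add: power2_eq_square)
  qed
  then have "(2::nat) ^ (4 * (i + 1)\<^sup>2) \<le> 2 ^ (4 * j * (j + 1))" by (intro power_increasing) auto
  ultimately show ?thesis by linarith
qed

lemma inj_on_windows: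
  assumes "\<And>i. i < k \<Longrightarrow> q i \<in> window i"
  shows "inj_on q {..<k}"
proof (rule linorder_inj_onI)
  fix i j assume "i < j" "i \<in> {..<k}" "j \<in> {..<k}"
  then show "q i \<noteq> q j" using window_mono[OF assms[of i] assms[of j]] by auto
qed auto

text \<open>Abbreviated \<open>F\<close> in the explanations. The product of the first \<open>k\<close> moduli is at least \<open>2 ^ F k\<close>, and
  so is the number of choices for them.\<close>

definition modulus_exponent :: "nat \<Rightarrow> nat" where
  "modulus_exponent k = (\<Sum>i<k. 4 * i * (i + 1))"

lemma two_power_modulus_exponent_le:
  assumes "\<And>i. i < k \<Longrightarrow> q i \<in> window i"
  shows "2 ^ modulus_exponent k \<le> (\<Prod>i<k. q i)"
proof -
  have "2 ^ modulus_exponent k = (\<Prod>i<k. 2 ^ (4 * i * (i + 1)) :: nat)"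
    unfolding modulus_exponent_def by (rule power_sum)
  also have "\<dots> \<le> (\<Prod>i<k. q i)"
    using assms by (intro prod_mono) (auto simp: window_def intro: less_imp_le)
  finally show ?thesis .
qed

text \<open>The difference of \<open>a\<close> and \<open>b\<close> is divisible by the product of the distinct primes \<open>q i\<close>, but smaller.
  The hypotheses bound it from both sides without subtraction of natural numbers.\<close>

lemma cong_all_windows_imp_eq:
  fixes a b :: nat
  assumes q: "\<And>i. i < k \<Longrightarrow> q i \<in> window i"
    and cong: "\<And>i. i < k \<Longrightarrow> [a = b] (mod q i)"
    and less: "a < 2 ^ modulus_exponent k + b" "b < 2 ^ modulus_exponent k + a"
  shows "a = b"
proof -
  have *: "x = y" if "y \<le> x" "\<And>i. i < k \<Longrightarrow> [x = y] (mod q i)" "x < 2 ^ modulus_exponent k + y" for x y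
  proof -
    have "(\<Prod>i<k. q i) dvd x - y"
      using that(1,2) q cong_altdef_nat[of y x]
      by (intro prod_primes_dvd inj_on_windows) (auto simp: window_def cong_sym_eq)
    moreover have "x - y < (\<Prod>i<k. q i)"
      using that(1,3) two_power_modulus_exponent_le[of k q] q by fastforce
    ultimately have "x - y = 0" by (meson dvd_imp_le gr0I not_le)
    then show "x = y" using that(1) by simp
  qed
  show ?thesis
    using *[of b a] *[of a b] cong less by (metis cong_sym nat_le_linear)
qed

lemma card_window_cong_le:
  fixes a b :: nat
  assumes "a \<noteq> b" "a \<le> 2 ^ n" "b \<le> 2 ^ n"
  shows "card {q\<in>window i. [a = b] (mod q)} \<le> n"
proof -
  define D where "D = max a b - min a b"
  have D: "0 < D" "D \<le> 2 ^ n" unfolding D_def using assms by auto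
  have fin: "finite {q\<in>window i. [a = b] (mod q)}" using finite_window by simp
  have "2 ^ card {q\<in>window i. [a = b] (mod q)} \<le> D"
  proof (rule two_power_card_prime_divisors_le[OF fin D(1)])
    fix p assume "p \<in> {q\<in>window i. [a = b] (mod q)}"
    then have "prime p" "[a = b] (mod p)" by (auto simp: window_def)
    then show "prime p \<and> p dvd D"
      unfolding D_def using cong_altdef_nat[of a b p] cong_altdef_nat[of b a p]
      by (cases "a \<le> b") (auto simp: cong_sym_eq max_def min_def)
  qed
  then have "(2::nat) ^ card {q\<in>window i. [a = b] (mod q)} \<le> 2 ^ n" using D(2) by linarith
  then show ?thesis by (rule power_le_imp_le_exp[rotated]) simp
qed

section \<open>Choosing the moduli by averaging\<close>

text \<open>What is required of the sizes \<open>2 ^ t k\<close> of the primes that are encoded, from some level \<open>k0\<close> on: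
  \<open>t_mono\<close> makes the levels disjoint; \<open>t_large\<close> makes these primes larger than the moduli, hence invertible modulo them; \<open>t_small\<close> lets
  the first \<open>k\<close> moduli separate products of two primes of level \<open>k\<close>; \<open>t_cube\<close> keeps the
  number of prime divisors of such products polynomial in \<open>k\<close>; \<open>t_critical\<close> is the condition
  that determines the exponent \<open>sqrt 2 - 1\<close>, with \<open>7 * k\<^sup>2\<close> bits to spare for lower order factors.\<close>

locale sidon_parameters =
  fixes t :: "nat \<Rightarrow> nat" and k0 :: nat
  assumes k0: "k0 \<ge> 1"
    and t_mono: "k \<ge> k0 \<Longrightarrow> t (k - 1) \<le> t k"
    and t_large: "k \<ge> k0 \<Longrightarrow> 4 * k\<^sup>2 \<le> t (k - 1)"
    and t_small: "k \<ge> k0 \<Longrightarrow> 2 * t k \<le> modulus_exponent k"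
    and t_cube: "t k \<le> k ^ 3"
    and t_critical: "k0 \<le> j \<Longrightarrow> j < k \<Longrightarrow> modulus_exponent j \<le> t k + t j \<Longrightarrow> t k + 2 * t j + 7 * k\<^sup>2 \<le> modulus_exponent k"
begin

definition level :: "nat \<Rightarrow> nat set" where
  "level k = {p. prime p \<and> 2 ^ t (k - 1) < p \<and> p \<le> 2 ^ t k}"

lemma finite_level: "finite (level k)"
  by (rule finite_subset[of _ "{..2 ^ t k}"]) (auto simp: level_def)

lemma card_level_le: "card (level k) \<le> 2 ^ t k"
proof -
  have "level k \<subseteq> {1..2 ^ t k}" by (auto simp: level_def Suc_leI prime_gt_0_nat)
  then show ?thesis using card_mono[of "{1..2 ^ t k}" "level k"] by simp
qed

text \<open>The quadruples \<open>(p, p', r, r')\<close> for which the congruences of \<open>matches\<close> would be a mere coincidence.\<close>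

definition colliding :: "nat \<Rightarrow> nat \<Rightarrow> (nat \<times> nat \<times> nat \<times> nat) set" where
  "colliding k j = {(p, p', r, r'). p \<in> level k \<and> p' \<in> level k \<and> r \<in> level j \<and> r' \<in> level j \<and>
    p \<noteq> p' \<and> p * r \<noteq> p' * r'}"

text \<open>The information about \<open>p, p'\<close> of level \<open>k\<close> and \<open>r, r'\<close> of level \<open>j\<close> that can be read off from an
  equation \<open>code p + code r = code p' + code r'\<close>.\<close>

definition matches :: "nat \<Rightarrow> nat \<Rightarrow> nat \<times> nat \<times> nat \<times> nat \<Rightarrow> (nat \<Rightarrow> nat) \<Rightarrow> bool" where
  "matches k j = (\<lambda>(p, p', r, r') q.
    (\<forall>i<j. [p * r = p' * r'] (mod q i)) \<and> (\<forall>i. j \<le> i \<and> i < k \<longrightarrow> [p = p'] (mod q i)))"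

definition bad :: "(nat \<Rightarrow> nat) \<Rightarrow> nat \<Rightarrow> nat set" where
  "bad q k = {p. \<exists>j p' r r'. k0 \<le> j \<and> j < k \<and> (p, p', r, r') \<in> colliding k j \<and> matches k j (p, p', r, r') q}"

lemma bad_subset: "bad q k \<subseteq> level k"
  by (auto simp: bad_def colliding_def)

lemma finite_colliding: "finite (colliding k j)"
  by (rule finite_subset[of _ "level k \<times> level k \<times> level j \<times> level j"])
    (auto simp: colliding_def finite_level)

lemma card_colliding_le: "card (colliding k j) \<le> card (level k) * 2 ^ (t k + 2 * t j)"
proof -
  have "card (colliding k j) \<le> card (level k \<times> level k \<times> level j \<times> level j)"
    by (rule card_mono) (auto simp: colliding_def finite_level)
  also have "\<dots> = card (level k) * (card (level k) * (card (level j) * card (level j)))"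
    by (simp add: card_cartesian_product)
  also have "\<dots> \<le> card (level k) * (2 ^ t k * (2 ^ t j * 2 ^ t j))"
    by (intro mult_mono card_level_le) auto
  also have "\<dots> = card (level k) * 2 ^ (t k + 2 * t j)"
    by (simp add: power_add mult_2)
  finally show ?thesis .
qed

lemma level_mult_le:
  assumes "p \<in> level k" "r \<in> level j"
  shows "p * r \<le> 2 ^ (t k + t j)" "0 < p * r"
proof -
  show "p * r \<le> 2 ^ (t k + t j)"
    unfolding power_add using assms by (intro mult_mono) (auto simp: level_def)
  show "0 < p * r" using assms by (auto simp: level_def prime_gt_0_nat)
qed

lemma t_mono_le: "k0 \<le> j \<Longrightarrow> j \<le> k \<Longrightarrow> t j \<le> t k"
proof (induction k)
  case (Suc k)
  then show ?case using t_mono[of "Suc k"] k0 by (cases "j = Suc k") auto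
qed simp

abbreviation choices :: "nat \<Rightarrow> (nat \<Rightarrow> nat) set" where
  "choices K \<equiv> PiE {..<K} window"

lemma finite_choices: "finite (choices K)"
  by (intro finite_PiE) (auto simp: finite_window)

text \<open>For \<open>i < k\<close> the modulus \<open>q i\<close> must be one of the few prime divisors of a fixed nonzero integer below
  \<open>2 ^ (2 * t k)\<close>, instead of an arbitrary element of its window.\<close>

lemma card_matches_le:
  assumes k: "k0 \<le> j" "j < k" "k \<le> K" and c: "c \<in> colliding k j"
  shows "card {q\<in>choices K. matches k j c q} * 2 ^ modulus_exponent k \<le> (2 * t k) ^ k * card (choices K)"
proof -
  obtain p p' r r' where c': "c = (p, p', r, r')" by (cases c)
  have mem: "p \<in> level k" "p' \<in> level k" "r \<in> level j" "r' \<in> level j" "p \<noteq> p'" "p * r \<noteq> p' * r'"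
    using c by (auto simp: c' colliding_def)
  have tj: "t j \<le> t k" using t_mono_le k by simp
  \<comment> \<open>The congruences restrict each modulus separately, so the matching choices form a box.\<close>
  define Y where "Y i = (if i < j then {q\<in>window i. [p * r = p' * r'] (mod q)}
    else if i < k then {q\<in>window i. [p = p'] (mod q)} else window i)" for i
  have "{q\<in>choices K. matches k j c q} \<subseteq> PiE {..<K} Y"
  proof
    fix q assume q: "q \<in> {q\<in>choices K. matches k j c q}"
    show "q \<in> PiE {..<K} Y"
    proof (rule PiE_I)
      fix i assume "i \<in> {..<K}"
      then show "q i \<in> Y i" using q by (auto simp: Y_def matches_def c' PiE_mem)
    next
      fix i assume "i \<notin> {..<K}"
      then show "q i = undefined" using q by (auto simp: PiE_def extensional_def)
    qed
  qed
  then have "card {q\<in>choices K. matches k j c q} \<le> card (PiE {..<K} Y)"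
    by (intro card_mono finite_PiE) (auto simp: Y_def finite_window)
  also have "\<dots> = (\<Prod>i<K. card (Y i))" by (simp add: card_PiE)
  finally have 1: "card {q\<in>choices K. matches k j c q} \<le> (\<Prod>i<K. card (Y i))" .
  have split: "(\<Prod>i<K. f i) = (\<Prod>i<k. f i) * (\<Prod>i=k..<K. f i)" for f :: "nat \<Rightarrow> nat"
    using prod.atLeastLessThan_concat[of 0 k K f] k by (simp add: atLeast0LessThan)
  have 2: "card (Y i) \<le> 2 * t k" if "i < k" for i
  proof (cases "i < j")
    case True
    have "(2::nat) ^ (t k + t j) \<le> 2 ^ (2 * t k)" using tj by (intro power_increasing) auto
    then have "p * r \<le> 2 ^ (2 * t k)" "p' * r' \<le> 2 ^ (2 * t k)"
      using level_mult_le(1)[OF mem(1,3)] level_mult_le(1)[OF mem(2,4)] by linarith+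
    then show ?thesis using card_window_cong_le[OF mem(6)] True by (simp add: Y_def)
  next
    case False
    have "(2::nat) ^ t k \<le> 2 ^ (2 * t k)" by (intro power_increasing) auto
    moreover have "p \<le> 2 ^ t k" "p' \<le> 2 ^ t k" using mem(1,2) by (auto simp: level_def)
    ultimately have "p \<le> 2 ^ (2 * t k)" "p' \<le> 2 ^ (2 * t k)" by linarith+
    then show ?thesis using card_window_cong_le[OF mem(5)] that False by (simp add: Y_def)
  qed
  have "(\<Prod>i<K. card (Y i)) = (\<Prod>i<k. card (Y i)) * (\<Prod>i=k..<K. card (Y i))" by (rule split)
  also have "\<dots> = (\<Prod>i<k. card (Y i)) * (\<Prod>i=k..<K. card (window i))"
    using k by (auto simp: Y_def intro!: prod.cong)
  also have "\<dots> \<le> (\<Prod>i<k. 2 * t k) * (\<Prod>i=k..<K. card (window i))"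
    using 2 by (intro mult_right_mono prod_mono) auto
  finally have 3: "(\<Prod>i<K. card (Y i)) \<le> (2 * t k) ^ k * (\<Prod>i=k..<K. card (window i))" by simp
  have "2 ^ modulus_exponent k = (\<Prod>i<k. 2 ^ (4 * i * (i + 1)) :: nat)"
    unfolding modulus_exponent_def by (rule power_sum)
  also have "\<dots> \<le> (\<Prod>i<k. card (window i))"
    using card_window by (intro prod_mono) auto
  finally have 4: "2 ^ modulus_exponent k \<le> (\<Prod>i<k. card (window i))" .
  have "card {q\<in>choices K. matches k j c q} * 2 ^ modulus_exponent k
      \<le> ((2 * t k) ^ k * (\<Prod>i=k..<K. card (window i))) * (\<Prod>i<k. card (window i))"
    using 1 3 4 by (intro mult_mono) auto
  also have "\<dots> = (2 * t k) ^ k * card (choices K)"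
    unfolding card_PiE[OF finite_lessThan] split by (simp add: mult_ac)
  finally show ?thesis .
qed

text \<open>If the levels are too far apart, the first \<open>j\<close> moduli are too large to divide \<open>p * r - p' * r'\<close>.
  This restriction on \<open>j\<close> is what makes the exponent exceed \<open>1/3\<close>: without it, \<open>t_critical\<close> would
  have to hold for \<open>j\<close> close to \<open>k\<close>.\<close>

lemma no_matches:
  assumes k: "j < k" "k \<le> K" and c: "c \<in> colliding k j" and F: "t k + t j < modulus_exponent j"
  shows "{q\<in>choices K. matches k j c q} = {}"
proof (rule ccontr)
  assume "{q\<in>choices K. matches k j c q} \<noteq> {}"
  then obtain q where q: "q \<in> choices K" "matches k j c q" by blast
  obtain p p' r r' where c': "c = (p, p', r, r')" by (cases c)
  have mem: "p \<in> level k" "p' \<in> level k" "r \<in> level j" "r' \<in> level j" "p * r \<noteq> p' * r'"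
    using c by (auto simp: c' colliding_def)
  have lt: "(2::nat) ^ (t k + t j) < 2 ^ modulus_exponent j" using F by (intro power_strict_increasing) auto
  have "p * r = p' * r'"
  proof (rule cong_all_windows_imp_eq[of j q])
    show "q i \<in> window i" if "i < j" for i using that q(1) k by (auto simp: PiE_mem)
    show "[p * r = p' * r'] (mod q i)" if "i < j" for i using that q(2) by (simp add: c' matches_def)
    show "p * r < 2 ^ modulus_exponent j + p' * r'" "p' * r' < 2 ^ modulus_exponent j + p * r"
      using level_mult_le[OF mem(1,3)] level_mult_le[OF mem(2,4)] lt by linarith+
  qed
  then show False using mem(5) by simp
qed

text \<open>The first moment: on average over the moduli, at most a proportion \<open>4 ^ (- k)\<close> of the primes of level
  \<open>k\<close> is bad. Summing the matching choices over all quadruples, the factors \<open>2 ^ (t k + 2 * t j)\<close>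
  and \<open>2 ^ (- F k)\<close> cancel by \<open>t_critical\<close>; one factor \<open>card (level k)\<close> is kept for the comparison.\<close>

lemma sum_card_bad_le:
  assumes k: "k0 \<le> k" "k \<le> K"
  shows "4 ^ k * (\<Sum>q\<in>choices K. card (bad q k)) \<le> card (level k) * card (choices K)"
proof -
  let ?M = "\<lambda>j c. {q\<in>choices K. matches k j c q}"
  have k1: "k \<ge> 1" using k k0 by simp
  have pointwise: "card (bad q k) \<le> (\<Sum>j=k0..<k. card {c\<in>colliding k j. matches k j c q})" for q
  proof -
    have "bad q k \<subseteq> (\<Union>j\<in>{k0..<k}. fst ` {c\<in>colliding k j. matches k j c q})"
      unfolding bad_def by force
    then have "card (bad q k) \<le> card (\<Union>j\<in>{k0..<k}. fst ` {c\<in>colliding k j. matches k j c q})"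
      by (intro card_mono) (auto simp: finite_colliding)
    also have "\<dots> \<le> (\<Sum>j=k0..<k. card (fst ` {c\<in>colliding k j. matches k j c q}))"
      by (rule card_UN_le) simp
    also have "\<dots> \<le> (\<Sum>j=k0..<k. card {c\<in>colliding k j. matches k j c q})"
      by (intro sum_mono card_image_le) (simp add: finite_colliding)
    finally show ?thesis .
  qed
  have swap: "(\<Sum>q\<in>choices K. card {c\<in>colliding k j. matches k j c q}) = (\<Sum>c\<in>colliding k j. card (?M j c))" for j
    by (rule sum_multicount_gen) (auto simp: finite_choices finite_colliding)
  have bound: "2 ^ (7 * k\<^sup>2) * (\<Sum>c\<in>colliding k j. card (?M j c)) \<le> card (level k) * ((2 * t k) ^ k * card (choices K))"
    if j: "k0 \<le> j" "j < k" for j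
  proof (cases "modulus_exponent j \<le> t k + t j")
    case False
    then have "card (?M j c) = 0" if "c \<in> colliding k j" for c
      using no_matches[OF j(2) k(2) that] by (simp only: not_le card.empty)
    then have "(\<Sum>c\<in>colliding k j. card (?M j c)) = 0" by simp
    then show ?thesis by simp
  next
    case True
    then have crit: "t k + 2 * t j + 7 * k\<^sup>2 \<le> modulus_exponent k" using t_critical j by simp
    have "(2 ^ (7 * k\<^sup>2) * (\<Sum>c\<in>colliding k j. card (?M j c))) * 2 ^ (t k + 2 * t j)
        = 2 ^ (t k + 2 * t j + 7 * k\<^sup>2) * (\<Sum>c\<in>colliding k j. card (?M j c))"
      by (simp add: power_add)
    also have "\<dots> \<le> 2 ^ modulus_exponent k * (\<Sum>c\<in>colliding k j. card (?M j c))"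
      using crit by (intro mult_right_mono power_increasing) auto
    also have "\<dots> = (\<Sum>c\<in>colliding k j. card (?M j c) * 2 ^ modulus_exponent k)"
      by (simp add: sum_distrib_left mult.commute)
    also have "\<dots> \<le> (\<Sum>c\<in>colliding k j. (2 * t k) ^ k * card (choices K))"
      using card_matches_le[OF j k(2)] by (intro sum_mono) auto
    also have "\<dots> = card (colliding k j) * ((2 * t k) ^ k * card (choices K))" by simp
    also have "\<dots> \<le> (card (level k) * 2 ^ (t k + 2 * t j)) * ((2 * t k) ^ k * card (choices K))"
      by (intro mult_right_mono card_colliding_le) simp
    also have "\<dots> = (card (level k) * ((2 * t k) ^ k * card (choices K))) * 2 ^ (t k + 2 * t j)"
      by (simp add: mult_ac)
    finally show ?thesis by simp
  qed
  \<comment> \<open>Of the \<open>7 k\<^sup>2\<close> spare bits, \<open>5 k\<^sup>2\<close> pay for the number of \<open>j\<close> and for the prime divisors,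
    and \<open>2 k\<^sup>2\<close> for the factor \<open>4 ^ k\<close>.\<close>
  have "2 ^ (7 * k\<^sup>2) * (\<Sum>q\<in>choices K. card (bad q k))
      \<le> 2 ^ (7 * k\<^sup>2) * (\<Sum>q\<in>choices K. \<Sum>j=k0..<k. card {c\<in>colliding k j. matches k j c q})"
    using pointwise by (intro mult_left_mono sum_mono) auto
  also have "\<dots> = (\<Sum>j=k0..<k. 2 ^ (7 * k\<^sup>2) * (\<Sum>c\<in>colliding k j. card (?M j c)))"
    unfolding sum.swap[of _ "{k0..<k}"] swap by (simp add: sum_distrib_left)
  also have "\<dots> \<le> (\<Sum>j=k0..<k. card (level k) * ((2 * t k) ^ k * card (choices K)))"
    using bound by (intro sum_mono) auto
  also have "\<dots> = (k - k0) * (2 * t k) ^ k * (card (level k) * card (choices K))" by (simp add: mult_ac)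
  also have "\<dots> \<le> 2 ^ (5 * k\<^sup>2) * (card (level k) * card (choices K))"
  proof (rule mult_right_mono)
    have "k \<le> 2 ^ k" by (simp add: less_imp_le)
    then have "k ^ 3 \<le> (2 ^ k) ^ 3" by (rule power_mono) simp
    then have "2 * t k \<le> 2 * (2 ^ k) ^ 3" using t_cube[of k] by linarith
    also have "\<dots> = 2 ^ (3 * k + 1)" by (simp add: mult.commute flip: power_mult)
    finally have "(2 * t k) ^ k \<le> (2 ^ (3 * k + 1)) ^ k" by (rule power_mono) simp
    moreover have "k - k0 \<le> 2 ^ k" by (rule le_trans[OF diff_le_self \<open>k \<le> 2 ^ k\<close>])
    ultimately have "(k - k0) * (2 * t k) ^ k \<le> 2 ^ k * (2 ^ (3 * k + 1)) ^ k" by (intro mult_mono) auto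
    also have "\<dots> = 2 ^ (k + (3 * k + 1) * k)" by (simp only: power_add power_mult)
    also have "\<dots> \<le> 2 ^ (5 * k\<^sup>2)"
    proof (rule power_increasing)
      have "k \<le> k * k" using k1 by simp
      then show "k + (3 * k + 1) * k \<le> 5 * k\<^sup>2" by (simp add: power2_eq_square algebra_simps)
    qed simp
    finally show "(k - k0) * (2 * t k) ^ k \<le> 2 ^ (5 * k\<^sup>2)" .
  qed simp
  finally have "2 ^ (5 * k\<^sup>2) * (2 ^ (2 * k\<^sup>2) * (\<Sum>q\<in>choices K. card (bad q k)))
      \<le> 2 ^ (5 * k\<^sup>2) * (card (level k) * card (choices K))"
    by (simp add: mult.assoc[symmetric] flip: power_add)
  then have "2 ^ (2 * k\<^sup>2) * (\<Sum>q\<in>choices K. card (bad q k)) \<le> card (level k) * card (choices K)" by simp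
  moreover have "(4::nat) ^ k \<le> 2 ^ (2 * k\<^sup>2)"
  proof -
    have "(4::nat) ^ k = 2 ^ (2 * k)" by (simp add: power_mult)
    also have "\<dots> \<le> 2 ^ (2 * k\<^sup>2)" using k1 by (intro power_increasing) (auto simp: power2_eq_square)
    finally show ?thesis .
  qed
  ultimately show ?thesis by (meson le_trans mult_le_mono1)
qed

text \<open>By Markov's inequality, level \<open>k\<close> has more than half of its primes bad for at most a proportion
  \<open>2 / 4 ^ k\<close> of the choices, and these proportions add up to less than \<open>2/3\<close>.\<close>

lemma ex_choice_finite: "\<exists>q\<in>choices K. \<forall>k. k0 \<le> k \<and> k \<le> K \<longrightarrow> 2 * card (bad q k) \<le> card (level k)"
proof (rule ccontr)
  let ?\<Omega> = "choices K"
  define E where "E k = {q\<in>?\<Omega>. card (level k) < 2 * card (bad q k)}" for k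
  assume "\<not> ?thesis"
  then have "?\<Omega> \<subseteq> (\<Union>k\<in>{k0..K}. E k)" unfolding E_def by (fastforce simp: not_le)
  then have "card ?\<Omega> \<le> card (\<Union>k\<in>{k0..K}. E k)"
    by (rule card_mono[rotated]) (simp add: E_def finite_choices)
  also have "\<dots> \<le> (\<Sum>k=k0..K. card (E k))" by (rule card_UN_le) simp
  finally have cover: "card ?\<Omega> \<le> (\<Sum>k=k0..K. card (E k))" .
  have E: "real (card (E k)) \<le> real (card ?\<Omega>) * (2 * (1 / 4) ^ k)" if k: "k \<in> {k0..K}" for k
  proof (cases "level k = {}")
    case True
    then have "E k = {}" using bad_subset[of _ k] by (auto simp: E_def)
    then show ?thesis by simp
  next
    case False
    then have L: "card (level k) > 0" using finite_level by (simp add: card_gt_0_iff)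
    have "card (E k) * card (level k) = (\<Sum>q\<in>E k. card (level k))" by simp
    also have "\<dots> \<le> (\<Sum>q\<in>E k. 2 * card (bad q k))" by (intro sum_mono) (auto simp: E_def)
    also have "\<dots> \<le> (\<Sum>q\<in>?\<Omega>. 2 * card (bad q k))"
      by (intro sum_mono2 finite_choices) (auto simp: E_def)
    also have "\<dots> = 2 * (\<Sum>q\<in>?\<Omega>. card (bad q k))" by (simp add: sum_distrib_left)
    finally have "4 ^ k * (card (E k) * card (level k)) \<le> 4 ^ k * (2 * (\<Sum>q\<in>?\<Omega>. card (bad q k)))"
      by (rule mult_left_mono) simp
    also have "\<dots> \<le> 2 * (card (level k) * card ?\<Omega>)"
      using sum_card_bad_le[of k K] k by simp
    finally have "card (level k) * (4 ^ k * card (E k)) \<le> card (level k) * (2 * card ?\<Omega>)"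
      by (simp add: mult_ac)
    then have "4 ^ k * card (E k) \<le> 2 * card ?\<Omega>" using L by simp
    then have "real (4 ^ k * card (E k)) \<le> real (2 * card ?\<Omega>)" by (rule of_nat_mono)
    then show ?thesis by (simp add: field_simps power_divide)
  qed
  have pos: "card ?\<Omega> > 0"
  proof -
    have "card (window i) > 0" for i using card_window[of i] by (metis gr0I le_zero_eq power_not_zero zero_neq_numeral)
    then show ?thesis by (simp add: card_PiE prod_pos)
  qed
  have geo: "(\<Sum>k=1..n. 2 * (1 / 4) ^ k) = (2/3 :: real) - (2/3) * (1/4) ^ n" for n
    by (induction n) simp_all
  have "real (card ?\<Omega>) \<le> (\<Sum>k=k0..K. real (card (E k)))"
    using of_nat_mono[OF cover, where 'a = real] by simp
  also have "\<dots> \<le> (\<Sum>k=k0..K. real (card ?\<Omega>) * (2 * (1 / 4) ^ k))" by (intro sum_mono E)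
  also have "\<dots> = real (card ?\<Omega>) * (\<Sum>k=k0..K. 2 * (1 / 4) ^ k)" by (simp add: sum_distrib_left)
  also have "\<dots> \<le> real (card ?\<Omega>) * (\<Sum>k=1..K. 2 * (1 / 4) ^ k)"
    using k0 by (intro mult_left_mono sum_mono2) auto
  also have "\<dots> \<le> real (card ?\<Omega>) * (2/3)"
  proof (rule mult_left_mono)
    have "(0::real) \<le> (2/3) * (1/4) ^ K" by simp
    then show "(\<Sum>k=1..K. 2 * (1 / 4) ^ k) \<le> (2/3 :: real)" using geo[of K] by linarith
  qed simp
  finally show False using pos by simp
qed

lemma bad_local:
  assumes "\<And>i. i < k \<Longrightarrow> f i = g i"
  shows "bad f k = bad g k"
proof -
  have "matches k j c f \<longleftrightarrow> matches k j c g" if "j < k" for j c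
    unfolding matches_def using assms that by (cases c) auto
  then show ?thesis unfolding bad_def by blast
qed

lemma ex_choice: "\<exists>q. (\<forall>i. q i \<in> window i) \<and> (\<forall>k\<ge>k0. 2 * card (bad q k) \<le> card (level k))"
proof -
  define G where "G k q \<longleftrightarrow> k \<ge> k0 \<longrightarrow> 2 * card (bad q k) \<le> card (level k)" for k q
  have "\<exists>f. (\<forall>i. f i \<in> window i) \<and> (\<forall>k. G k f)"
  proof (rule koenig_finite_choices)
    show "finite (window i)" for i by (rule finite_window)
    show "G k g" if "\<And>i. i < k \<Longrightarrow> f i = g i" "G k f" for k f g
      using that(2) bad_local[of k f g] that(1) unfolding G_def by simp
    show "\<exists>f. (\<forall>i<K. f i \<in> window i) \<and> (\<forall>k\<le>K. G k f)" for K
    proof -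
      obtain q where q: "q \<in> choices K" "\<And>k. k0 \<le> k \<Longrightarrow> k \<le> K \<Longrightarrow> 2 * card (bad q k) \<le> card (level k)"
        using ex_choice_finite[of K] by blast
      then show ?thesis unfolding G_def by (intro exI[of _ q]) (auto simp: PiE_mem)
    qed
  qed
  then show ?thesis unfolding G_def by blast
qed

end

section \<open>The Sidon set of codes of primes\<close>

definition base :: "nat \<Rightarrow> nat" where "base i = 4 * 2 ^ (4 * (i + 1)\<^sup>2)"

text \<open>The offset \<open>2 ^ (4 * (i + 1)\<^sup>2)\<close> is at least \<open>q i\<close>, so one digit lies between one and two
  offsets and the sum of two digits between two and four. The sum of the \<open>i\<close>-th digits of two codes
  thus tells how many of the two levels exceed \<open>i\<close>, and it stays below \<open>base i\<close>.\<close>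

definition digit :: "(nat \<Rightarrow> nat \<Rightarrow> nat) \<Rightarrow> nat \<Rightarrow> nat \<Rightarrow> nat \<Rightarrow> nat" where
  "digit l k p i = (if i < k then 2 ^ (4 * (i + 1)\<^sup>2) + l i p else 0)"

definition code :: "(nat \<Rightarrow> nat \<Rightarrow> nat) \<Rightarrow> nat \<Rightarrow> nat \<Rightarrow> nat" where
  "code l k p = (\<Sum>i<k. digit l k p i * (\<Prod>j<i. base j))"

lemma code_eq_sum:
  assumes "k \<le> K"
  shows "code l k p = (\<Sum>i<K. digit l k p i * (\<Prod>j<i. base j))"
  unfolding code_def using assms by (intro sum.mono_neutral_left) (auto simp: digit_def)

locale prime_codes = sidon_parameters +
  fixes q :: "nat \<Rightarrow> nat" and l :: "nat \<Rightarrow> nat \<Rightarrow> nat"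
  assumes q: "q i \<in> window i"
    and few_bad: "k0 \<le> k \<Longrightarrow> 2 * card (bad q k) \<le> card (level k)"
    and l_less: "coprime n (q i) \<Longrightarrow> l i n < q i"
    and l_log: "coprime a (q i) \<Longrightarrow> coprime b (q i) \<Longrightarrow> coprime c (q i) \<Longrightarrow> coprime d (q i) \<Longrightarrow>
      l i a + l i b = l i c + l i d \<Longrightarrow> [a * b = c * d] (mod q i)"
begin

text \<open>Both numbers are prime, and \<open>t_large\<close> makes \<open>p\<close> the larger one.\<close>

lemma coprime_level:
  assumes "p \<in> level k" "i < k" "k0 \<le> k"
  shows "coprime p (q i)"
proof (rule primes_coprime)
  show "prime p" "prime (q i)" using assms(1) q[of i] by (auto simp: level_def window_def)
  have "(i + 1)\<^sup>2 \<le> k\<^sup>2" using assms(2) by (intro power_mono) auto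
  then have "4 * (i + 1)\<^sup>2 \<le> t (k - 1)" using t_large[OF assms(3)] by linarith
  then have "(2::nat) ^ (4 * (i + 1)\<^sup>2) \<le> 2 ^ t (k - 1)" by (intro power_increasing) auto
  moreover have "2 ^ t (k - 1) < p" "q i \<le> 2 ^ (4 * (i + 1)\<^sup>2)"
    using assms(1) q[of i] by (simp_all add: level_def window_def)
  ultimately show "p \<noteq> q i" by linarith
qed

lemma digit_bounds:
  assumes "p \<in> level k" "i < k" "k0 \<le> k"
  shows "2 ^ (4 * (i + 1)\<^sup>2) \<le> digit l k p i" "digit l k p i < 2 * 2 ^ (4 * (i + 1)\<^sup>2)"
  using l_less[OF coprime_level[OF assms]] q[of i] assms(2) by (auto simp: digit_def window_def)

lemma double_digit_less:
  assumes "p \<in> level k" "k0 \<le> k"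
  shows "2 * digit l k p i < base i"
  using digit_bounds(2)[OF assms(1) _ assms(2), of i] by (cases "i < k") (auto simp: base_def digit_def)

lemma digit_less:
  assumes "p \<in> level k" "k0 \<le> k"
  shows "digit l k p i < base i"
  using double_digit_less[OF assms, of i] by linarith

lemma code_less:
  assumes "p \<in> level k" "k0 \<le> k"
  shows "code l k p < (\<Prod>i<k. base i)"
  unfolding code_def using digit_less[OF assms] by (rule mixed_radix_less)

lemma code_pos:
  assumes "p \<in> level k" "k0 \<le> k"
  shows "0 < code l k p"
proof -
  have k: "0 < k" using assms(2) k0 by simp
  have "0 < digit l k p 0 * (\<Prod>j<0. base j)" using digit_bounds(1)[OF assms(1) k assms(2)]
    by (simp add: digit_def k)
  also have "\<dots> \<le> code l k p" unfolding code_def using k by (intro member_le_sum) auto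
  finally show ?thesis .
qed

lemma small_exponent:
  assumes "k0 \<le> k"
  shows "t k < modulus_exponent k"
proof -
  have "4 * 1\<^sup>2 \<le> 4 * k\<^sup>2" using assms k0 by (intro mult_left_mono power_mono) auto
  then have "0 < t k" using t_large[OF assms] t_mono[OF assms] by simp
  then show ?thesis using t_small[OF assms] by simp
qed

text \<open>A prime of level \<open>k\<close> is determined by its residues, since \<open>2 ^ t k\<close> is smaller than the product
  of the moduli.\<close>

lemma level_eqI:
  assumes "k0 \<le> k" "p \<in> level k" "p' \<in> level k" "\<And>i. i < k \<Longrightarrow> [p = p'] (mod q i)"
  shows "p = p'"
proof (rule cong_all_windows_imp_eq[of k q])
  have "(2::nat) ^ t k < 2 ^ modulus_exponent k" using small_exponent[OF assms(1)] by (intro power_strict_increasing) auto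
  moreover have "p \<le> 2 ^ t k" "p' \<le> 2 ^ t k" using assms(2,3) by (simp_all add: level_def)
  ultimately show "p < 2 ^ modulus_exponent k + p'" "p' < 2 ^ modulus_exponent k + p" by linarith+
qed (use assms q in auto)

lemma level_disjoint:
  assumes "p \<in> level j" "p \<in> level k" "k0 \<le> j" "k0 \<le> k"
  shows "j = k"
proof -
  have *: False if "p \<in> level j" "p \<in> level k" "k0 \<le> j" "j < k" for j k
  proof -
    have "t j \<le> t (k - 1)" using that by (intro t_mono_le) auto
    then have "(2::nat) ^ t j \<le> 2 ^ t (k - 1)" by (intro power_increasing) auto
    moreover have "p \<le> 2 ^ t j" "2 ^ t (k - 1) < p" using that(1,2) by (simp_all add: level_def)
    ultimately show False by linarith
  qed
  show ?thesis using *[of j k] *[of k j] assms by (cases j k rule: linorder_cases) auto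
qed

lemma l_log_single:
  assumes "p \<in> level k" "p' \<in> level k" "i < k" "k0 \<le> k" "l i p = l i p'"
  shows "[p = p'] (mod q i)"
  using l_log[of p i 1 p' 1] coprime_level[OF assms(1,3,4)] coprime_level[OF assms(2,3,4)] assms(5) by simp

lemma inj_on_code: "k0 \<le> k \<Longrightarrow> inj_on (code l k) (level k)"
proof (rule inj_onI)
  fix p p' assume k: "k0 \<le> k" and p: "p \<in> level k" "p' \<in> level k" and eq: "code l k p = code l k p'"
  have "digit l k p i = digit l k p' i" if "i < k" for i
    by (rule mixed_radix_unique[OF digit_less[OF p(1) k] digit_less[OF p(2) k] eq[unfolded code_def] that])
  then have "l i p = l i p'" if "i < k" for i using that by (auto simp: digit_def)
  then show "p = p'" using level_eqI[OF k p] l_log_single[OF p _ k] by blast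
qed

text \<open>Addition of two codes produces no carries.\<close>

lemma code_add_eq_imp_digits:
  assumes p: "p \<in> level k" "r \<in> level j" "p' \<in> level k'" "r' \<in> level j'"
    and k: "k0 \<le> k" "k0 \<le> j" "k0 \<le> k'" "k0 \<le> j'"
    and eq: "code l k p + code l j r = code l k' p' + code l j' r'"
  shows "digit l k p i + digit l j r i = digit l k' p' i + digit l j' r' i"
proof -
  define K where "K = k + j + k' + j' + i + 1"
  have K: "k \<le> K" "j \<le> K" "k' \<le> K" "j' \<le> K" "i < K" by (auto simp: K_def)
  let ?s = "\<lambda>i. digit l k p i + digit l j r i" and ?s' = "\<lambda>i. digit l k' p' i + digit l j' r' i"
  have "?s i < base i" "?s' i < base i" for i
    using double_digit_less[OF p(1) k(1), of i] double_digit_less[OF p(2) k(2), of i] double_digit_less[OF p(3) k(3), of i]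
      double_digit_less[OF p(4) k(4), of i] by linarith+
  moreover have "(\<Sum>i<K. ?s i * (\<Prod>j<i. base j)) = (\<Sum>i<K. ?s' i * (\<Prod>j<i. base j))"
    using eq unfolding code_eq_sum[OF K(1)] code_eq_sum[OF K(2)] code_eq_sum[OF K(3)] code_eq_sum[OF K(4)]
    by (simp add: add_mult_distrib sum.distrib)
  ultimately show ?thesis using mixed_radix_unique[of K ?s base ?s' i] K(5) by blast
qed

lemma code_add_eq_imp_levels:
  assumes p: "p \<in> level k" "r \<in> level j" "p' \<in> level k'" "r' \<in> level j'"
    and k: "k0 \<le> k" "k0 \<le> j" "k0 \<le> k'" "k0 \<le> j'" and le: "j \<le> k" "j' \<le> k'"
    and eq: "code l k p + code l j r = code l k' p' + code l j' r'"
  shows "k \<le> k' \<and> j \<le> j'"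
proof -
  note d = code_add_eq_imp_digits[OF p k eq]
  have "k \<le> k'"
  proof (rule ccontr)
    assume "\<not> k \<le> k'"
    then have "k' < k" "j' \<le> k'" using le by auto
    moreover have "digit l k' p' k' = 0" "digit l j' r' k' = 0" using le by (auto simp: digit_def)
    moreover have "(0::nat) < 2 ^ (4 * (k' + 1)\<^sup>2)" by simp
    ultimately show False using d[of k'] digit_bounds(1)[OF p(1) \<open>k' < k\<close> k(1)] by linarith
  qed
  moreover have "j \<le> j'"
  proof (rule ccontr)
    assume "\<not> j \<le> j'"
    then have j': "j' < j" "j' < k" using le by auto
    have "digit l k' p' j' < 2 * 2 ^ (4 * (j' + 1)\<^sup>2)"
      using digit_bounds(2)[OF p(3) _ k(3), of j'] by (cases "j' < k'") (auto simp: digit_def)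
    moreover have "digit l j' r' j' = 0" by (simp add: digit_def)
    ultimately show False
      using d[of j'] digit_bounds(1)[OF p(1) j'(2) k(1)] digit_bounds(1)[OF p(2) j'(1) k(2)] by linarith
  qed
  ultimately show ?thesis ..
qed

text \<open>The core of the argument. If \<open>p = p'\<close>, cancellation and \<open>level_eqI\<close> give \<open>r = r'\<close>; if the products
  agree, unique factorisation and the disjointness of levels apply; otherwise \<open>p\<close> is bad when \<open>j < k\<close>,
  and the congruences are contradictory when \<open>j = k\<close>.\<close>

lemma code_add_eq:
  assumes p: "p \<in> level k" "r \<in> level j" "p' \<in> level k" "r' \<in> level j"
    and k: "k0 \<le> k" "k0 \<le> j" "j \<le> k" and good: "p \<notin> bad q k"
    and eq: "code l k p + code l j r = code l k p' + code l j r'"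
  shows "(p = p' \<and> r = r') \<or> (k = j \<and> p = r' \<and> r = p')"
proof -
  note d = code_add_eq_imp_digits[OF p k(1,2) k(1,2) eq]
  have cop: "coprime p (q i)" "coprime p' (q i)" if "i < k" for i
    using coprime_level p k that by auto
  have cop': "coprime r (q i)" "coprime r' (q i)" if "i < j" for i
    using coprime_level p k that by auto
  have low: "[p * r = p' * r'] (mod q i)" if "i < j" for i
    using d[of i] that k(3) by (intro l_log cop cop') (auto simp: digit_def)
  have high: "[p = p'] (mod q i)" if "j \<le> i" "i < k" for i
    using d[of i] that by (intro l_log_single[OF p(1,3) that(2) k(1)]) (auto simp: digit_def)
  have prime: "prime p" "prime p'" "prime r" "prime r'" using p by (auto simp: level_def)
  show ?thesis
  proof (cases "p = p'")
    case True
    have "[r = r'] (mod q i)" if "i < j" for i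
      using low[OF that] cop[of i] that k(3) unfolding True by (simp add: cong_mult_lcancel_nat)
    then have "r = r'" using level_eqI[OF k(2) p(2,4)] by blast
    then show ?thesis using True by simp
  next
    case False
    show ?thesis
    proof (cases "p * r = p' * r'")
      case True
      then have "p dvd p' * r'" "r dvd p' * r'" by (metis dvd_triv_left, metis dvd_triv_right)
      then have "p = r'" using prime False by (metis prime_dvd_mult_iff primes_dvd_imp_eq)
      moreover from this have "r = p'" using True prime by (metis mult.commute mult_left_cancel not_prime_0)
      moreover have "k = j" using level_disjoint[OF p(1) _ k(1,2)] p(4) \<open>p = r'\<close> by simp
      ultimately show ?thesis by simp
    next
      case neq: False
      show ?thesis
      proof (cases "j < k")
        case True
        have "(p, p', r, r') \<in> colliding k j" using p False neq by (simp add: colliding_def)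
        moreover have "matches k j (p, p', r, r') q" using low high by (simp add: matches_def)
        ultimately have "p \<in> bad q k" using True k(2) unfolding bad_def by blast
        then show ?thesis using good by simp
      next
        case nless: False
        \<comment> \<open>For equal levels there are enough congruences to force equality of the products.\<close>
        then have kj: "j = k" using k(3) by simp
        have le: "(2::nat) ^ (t k + t j) \<le> 2 ^ modulus_exponent k"
          using t_small[OF k(1)] kj by (intro power_increasing) auto
        have "p * r = p' * r'"
        proof (rule cong_all_windows_imp_eq[of k q])
          show "p * r < 2 ^ modulus_exponent k + p' * r'" "p' * r' < 2 ^ modulus_exponent k + p * r"
            using level_mult_le[OF p(1,2)] level_mult_le[OF p(3,4)] le by linarith+
        qed (use low kj q in auto)
        then show ?thesis using neq by simp
      qed
    qed
  qed
qed

definition codes :: "int set" where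
  "codes = {int (code l k p) |k p. k0 \<le> k \<and> p \<in> level k - bad q k}"

text \<open>It remains to put the larger level first on each side of an equation of sums. Only the
  element of larger level on one side needs to be good.\<close>

lemma sidon_codes: "sidon codes"
proof -
  have main: "(code l k p = code l k' p' \<and> code l j r = code l j' r') \<or>
      (code l k p = code l j' r' \<and> code l j r = code l k' p')"
    if p: "p \<in> level k - bad q k" "r \<in> level j" "p' \<in> level k'" "r' \<in> level j'"
    and k: "k0 \<le> k" "k0 \<le> j" "k0 \<le> k'" "k0 \<le> j'" and le: "j \<le> k" "j' \<le> k'"
    and eq: "code l k p + code l j r = code l k' p' + code l j' r'" for k p j r k' p' j' r'
  proof -
    have "k = k'" "j = j'"
      using code_add_eq_imp_levels[of p k r j p' k' r' j'] code_add_eq_imp_levels[of p' k' r' j' p k r j] that by auto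
    then show ?thesis using code_add_eq[of p k r j p' r'] that by auto
  qed
  show ?thesis unfolding sidon_def
  proof (intro ballI impI)
    fix a b c d assume "a \<in> codes" "b \<in> codes" "c \<in> codes" "d \<in> codes" and eq: "a + b = c + d"
    then obtain k p j r k' p' j' r' where
      p: "p \<in> level k - bad q k" "r \<in> level j - bad q j" "p' \<in> level k' - bad q k'" "r' \<in> level j' - bad q j'"
      and k: "k0 \<le> k" "k0 \<le> j" "k0 \<le> k'" "k0 \<le> j'"
      and abcd: "a = int (code l k p)" "b = int (code l j r)" "c = int (code l k' p')" "d = int (code l j' r')"
      unfolding codes_def by blast
    have eq': "code l k p + code l j r = code l k' p' + code l j' r'"
      using eq unfolding abcd by (simp only: of_nat_add[symmetric] of_nat_eq_iff)
    have "(code l k p = code l k' p' \<and> code l j r = code l j' r') \<or>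
      (code l k p = code l j' r' \<and> code l j r = code l k' p')"
    proof (cases "j \<le> k"; cases "j' \<le> k'")
      assume "j \<le> k" "j' \<le> k'"
      then show ?thesis using main[of p k r j p' k' r' j'] p k eq' by simp
    next
      assume "j \<le> k" "\<not> j' \<le> k'"
      then show ?thesis using main[of p k r j r' j' p' k'] p k eq' by (simp add: add.commute disj_commute)
    next
      assume "\<not> j \<le> k" "j' \<le> k'"
      then show ?thesis using main[of r j p k p' k' r' j'] p k eq' by (simp add: add.commute disj_commute conj_commute)
    next
      assume "\<not> j \<le> k" "\<not> j' \<le> k'"
      then show ?thesis using main[of r j p k r' j' p' k'] p k eq' by (simp add: add.commute conj_commute)
    qed
    then show "(a = c \<and> b = d) \<or> (a = d \<and> b = c)" unfolding abcd by auto
  qed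
qed

lemma codes_pos: "codes \<subseteq> {0<..}"
  using code_pos by (auto simp: codes_def)

lemma card_codes:
  assumes k: "k0 \<le> k"
  shows "card (level k) \<le> 2 * card {b\<in>codes. b < int (\<Prod>i<k. base i)}"
proof -
  let ?S = "(\<lambda>p. int (code l k p)) ` (level k - bad q k)"
  have "?S \<subseteq> {b\<in>codes. b < int (\<Prod>i<k. base i)}"
    using code_less[OF _ k] k unfolding codes_def by (auto simp del: of_nat_prod)
  moreover have "finite {b\<in>codes. b < int (\<Prod>i<k. base i)}"
    by (rule finite_subset[of _ "{0..int (\<Prod>i<k. base i)}"]) (use codes_pos in auto)
  ultimately have "card ?S \<le> card {b\<in>codes. b < int (\<Prod>i<k. base i)}" by (rule card_mono[rotated])
  moreover have "card ?S = card (level k - bad q k)"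
    using inj_on_code[OF k] by (intro card_image) (auto simp: inj_on_def)
  moreover have "card (level k - bad q k) = card (level k) - card (bad q k)"
    using bad_subset finite_level by (intro card_Diff_subset finite_subset[OF bad_subset]) auto
  ultimately show ?thesis using few_bad[OF k] by linarith
qed

end

text \<open>Good moduli exist by averaging, and at least half of the primes of each level are not bad for them.
  The product of the bases is the trivial upper bound for the codes of level \<open>k\<close>.\<close>

theorem (in sidon_parameters) ex_sidon_set:
  "\<exists>B. sidon B \<and> B \<subseteq> {0<..} \<and> (\<forall>k\<ge>k0. card (level k) \<le> 2 * card {b\<in>B. b < int (\<Prod>i<k. base i)})"
proof -
  obtain q where q: "\<And>i. q i \<in> window i" "\<And>k. k0 \<le> k \<Longrightarrow> 2 * card (bad q k) \<le> card (level k)"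
    using ex_choice by blast
  have "\<exists>l :: nat \<Rightarrow> nat. (\<forall>n. coprime n (q i) \<longrightarrow> l n < q i) \<and>
    (\<forall>a b c d. coprime a (q i) \<longrightarrow> coprime b (q i) \<longrightarrow> coprime c (q i) \<longrightarrow> coprime d (q i) \<longrightarrow>
      l a + l b = l c + l d \<longrightarrow> [a * b = c * d] (mod q i))" for i
    using q(1)[of i] by (intro ex_discrete_log) (simp add: window_def)
  then obtain l where l: "\<And>i. (\<forall>n. coprime n (q i) \<longrightarrow> l i n < q i) \<and>
    (\<forall>a b c d. coprime a (q i) \<longrightarrow> coprime b (q i) \<longrightarrow> coprime c (q i) \<longrightarrow> coprime d (q i) \<longrightarrow>
      l i a + l i b = l i c + l i d \<longrightarrow> [a * b = c * d] (mod q i))" by metis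
  interpret prime_codes t k0 q l
  proof unfold_locales
    show "q i \<in> window i" for i by (rule q)
    show "2 * card (bad q k) \<le> card (level k)" if "k0 \<le> k" for k using that by (rule q)
    show "l i n < q i" if "coprime n (q i)" for i n using l[of i] that by simp
    show "[a * b = c * d] (mod q i)" if "coprime a (q i)" "coprime b (q i)" "coprime c (q i)" "coprime d (q i)"
      "l i a + l i b = l i c + l i d" for i a b c d
      using conjunct2[OF l[of i], rule_format, OF that] .
  qed
  show ?thesis using sidon_codes codes_pos card_codes by (intro exI[of _ codes]) simp
qed

section \<open>The exponents\<close>

text \<open>In the conditions on the parameters, the exponent enters only through \<open>\<gamma>\<^sup>2 = 1 - 2 * \<gamma>\<close> and \<open>0 < \<gamma> < 1/2\<close>.\<close>

abbreviation "\<gamma> \<equiv> sqrt 2 - 1"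

lemma gamma_bounds: "0 < \<gamma>" "\<gamma> < 1 / 2" and gamma_square: "\<gamma>\<^sup>2 = 1 - 2 * \<gamma>"
proof -
  show "0 < \<gamma>" by simp
  have "sqrt 2 < 3 / 2" by (rule real_less_lsqrt) (simp_all add: power2_eq_square)
  then show "\<gamma> < 1 / 2" by simp
  show "\<gamma>\<^sup>2 = 1 - 2 * \<gamma>" by (simp add: power2_eq_square algebra_simps)
qed

lemma real_modulus_exponent: "real (modulus_exponent k) = 4 / 3 * (real k ^ 3 - real k)"
  unfolding modulus_exponent_def by (induction k) (simp_all add: power3_eq_cube algebra_simps)

definition code_exponent :: "nat \<Rightarrow> nat" where
  "code_exponent k = (\<Sum>i<k. 4 * (i + 1)\<^sup>2 + 2)"

lemma prod_base: "(\<Prod>i<k. base i) = 2 ^ code_exponent k"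
  unfolding code_exponent_def power_sum by (simp add: base_def power_add mult.commute)

lemma real_code_exponent: "real (code_exponent k) = (4 * real k ^ 3 + 6 * real k ^ 2 + 8 * real k) / 3"
  unfolding code_exponent_def
  by (induction k) (simp_all add: power3_eq_cube power2_eq_square algebra_simps)

text \<open>This is \<open>\<gamma> * F k - 7 * k\<^sup>2\<close>: the critical size, lowered by the spare bits that \<open>t_critical\<close> asks for.\<close>

definition raw_exponent :: "nat \<Rightarrow> real" where
  "raw_exponent k = \<gamma> * (4 / 3 * (real k ^ 3 - real k)) - 7 * real k ^ 2"

definition level_exponent :: "nat \<Rightarrow> nat" where
  "level_exponent k = nat \<lfloor>raw_exponent k\<rfloor>"

lemma level_exponent_le: "0 \<le> raw_exponent k \<Longrightarrow> real (level_exponent k) \<le> raw_exponent k"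
  unfolding level_exponent_def by simp

lemma level_exponent_ge: "raw_exponent k - 1 \<le> real (level_exponent k)"
  unfolding level_exponent_def by linarith

lemma level_exponent_cube: "level_exponent k \<le> k ^ 3"
proof -
  have "\<gamma> * (4 / 3 * (real k ^ 3 - real k)) \<le> \<gamma> * (4 / 3 * real k ^ 3)"
    using gamma_bounds(1) by (intro mult_left_mono) auto
  also have "\<dots> \<le> (1 / 2) * (4 / 3 * real k ^ 3)"
    using gamma_bounds(2) by (intro mult_right_mono) auto
  also have "\<dots> \<le> real k ^ 3" by simp
  finally have "\<gamma> * (4 / 3 * (real k ^ 3 - real k)) \<le> real k ^ 3" .
  moreover have "0 \<le> 7 * real k ^ 2" by simp
  ultimately have "raw_exponent k \<le> real (k ^ 3)" unfolding raw_exponent_def of_nat_power by linarith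
  then have "\<lfloor>raw_exponent k\<rfloor> \<le> int (k ^ 3)" by linarith
  then show ?thesis unfolding level_exponent_def by (simp only: nat_le_iff)
qed

lemma eventually_raw_exponent:
  "\<forall>\<^sub>F k in sequentially. 0 \<le> raw_exponent k \<and> raw_exponent (k - 1) + real k \<le> raw_exponent k - 1
    \<and> 4 * real k ^ 2 \<le> raw_exponent (k - 1) - 1 \<and> 4 * real k ^ 3 \<le> 2 ^ k"
proof -
  have 1: "\<forall>\<^sub>F k in sequentially. 0 \<le> raw_exponent k"
    unfolding raw_exponent_def by real_asymp
  have 2: "\<forall>\<^sub>F k in sequentially. raw_exponent k + (real k + 1) \<le> raw_exponent (Suc k) - 1"
    unfolding raw_exponent_def of_nat_Suc by real_asymp
  have 3: "\<forall>\<^sub>F k in sequentially. 4 * (real k + 1) ^ 2 \<le> raw_exponent k - 1"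
    unfolding raw_exponent_def by real_asymp
  have 4: "\<forall>\<^sub>F k in sequentially. 4 * real k ^ 3 \<le> 2 ^ k"
    by real_asymp
  have "\<forall>\<^sub>F k in sequentially. raw_exponent (k - 1) + real k \<le> raw_exponent k - 1"
    by (rule eventually_sequentially_Suc[THEN iffD1]) (use 2 in \<open>simp add: add.commute\<close>)
  moreover have "\<forall>\<^sub>F k in sequentially. 4 * real k ^ 2 \<le> raw_exponent (k - 1) - 1"
    by (rule eventually_sequentially_Suc[THEN iffD1]) (use 3 in \<open>simp add: add.commute\<close>)
  ultimately show ?thesis using 1 4 by eventually_elim auto
qed

text \<open>With \<open>t \<le> \<gamma> F\<close>, the hypothesis gives \<open>(1 - \<gamma>) F j \<le> \<gamma> F k\<close>, whence \<open>2 t j \<le> 2 \<gamma>\<^sup>2 / (1 - \<gamma>) F k\<close>.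
  The equation for \<open>\<gamma>\<close> says that \<open>2 \<gamma>\<^sup>2 / (1 - \<gamma>) = 1 - \<gamma>\<close>, which is exactly what is left beside
  \<open>t k \<le> \<gamma> F k - 7 * k\<^sup>2\<close>.\<close>

lemma level_exponent_critical:
  assumes nonneg: "0 \<le> raw_exponent k" "0 \<le> raw_exponent j" and F: "modulus_exponent j \<le> level_exponent k + level_exponent j"
  shows "level_exponent k + 2 * level_exponent j + 7 * k\<^sup>2 \<le> modulus_exponent k"
proof -
  have k: "real (level_exponent k) \<le> \<gamma> * real (modulus_exponent k) - 7 * real k ^ 2"
    using level_exponent_le[OF nonneg(1)] unfolding raw_exponent_def real_modulus_exponent .
  have "real (level_exponent j) \<le> \<gamma> * real (modulus_exponent j) - 7 * real j ^ 2"
    using level_exponent_le[OF nonneg(2)] unfolding raw_exponent_def real_modulus_exponent .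
  moreover have "0 \<le> 7 * real j ^ 2" "0 \<le> 7 * real k ^ 2" by simp_all
  ultimately have j: "real (level_exponent j) \<le> \<gamma> * real (modulus_exponent j)" by linarith
  have "real (modulus_exponent j) \<le> real (level_exponent k) + real (level_exponent j)" using F by linarith
  then have "real (modulus_exponent j) \<le> \<gamma> * real (modulus_exponent k) + \<gamma> * real (modulus_exponent j)"
    using k j \<open>0 \<le> 7 * real k ^ 2\<close> by linarith
  then have "(1 - \<gamma>) * real (modulus_exponent j) \<le> \<gamma> * real (modulus_exponent k)" by (simp add: algebra_simps)
  then have "2 * \<gamma> * ((1 - \<gamma>) * real (modulus_exponent j)) \<le> 2 * \<gamma> * (\<gamma> * real (modulus_exponent k))"
    using gamma_bounds by (intro mult_left_mono) auto
  also have "\<dots> = (2 * \<gamma>\<^sup>2) * real (modulus_exponent k)" by (simp add: power2_eq_square mult_ac)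
  also have "2 * \<gamma>\<^sup>2 = (1 - \<gamma>) * (1 - \<gamma>)"
    using gamma_square by (simp add: power2_eq_square algebra_simps)
  finally have "(1 - \<gamma>) * (2 * \<gamma> * real (modulus_exponent j)) \<le> (1 - \<gamma>) * ((1 - \<gamma>) * real (modulus_exponent k))"
    by (simp add: mult_ac)
  moreover have "1 - \<gamma> > 0" using gamma_bounds by linarith
  ultimately have "2 * \<gamma> * real (modulus_exponent j) \<le> (1 - \<gamma>) * real (modulus_exponent k)" by (simp only: mult_le_cancel_left_pos)
  then have "real (level_exponent k) + 2 * real (level_exponent j) + 7 * real k ^ 2 \<le> real (modulus_exponent k)"
    using k j by (simp add: algebra_simps)
  then have "real (level_exponent k + 2 * level_exponent j + 7 * k\<^sup>2) \<le> real (modulus_exponent k)" by simp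
  then show ?thesis by (simp only: of_nat_le_iff)
qed

lemma ex_sidon_parameters:
  "\<exists>k0. sidon_parameters level_exponent k0 \<and> (\<forall>k\<ge>k0.
    4 * real k ^ 3 \<le> 2 ^ k \<and> level_exponent (k - 1) + k \<le> level_exponent k)"
proof -
  obtain k1 where k1: "\<And>k. k \<ge> k1 \<Longrightarrow> 0 \<le> raw_exponent k \<and> raw_exponent (k - 1) + real k \<le> raw_exponent k - 1
    \<and> 4 * real k ^ 2 \<le> raw_exponent (k - 1) - 1 \<and> 4 * real k ^ 3 \<le> 2 ^ k"
    using eventually_raw_exponent unfolding eventually_sequentially by blast
  define k0 where "k0 = Suc k1"
  have k0: "k \<ge> k1 \<and> k - 1 \<ge> k1 \<and> 1 \<le> k" if "k \<ge> k0" for k using that unfolding k0_def by auto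
  have gap: "level_exponent (k - 1) + k \<le> level_exponent k" if k: "k \<ge> k0" for k
  proof -
    have "real (level_exponent (k - 1)) + real k \<le> real (level_exponent k)"
      using level_exponent_le[of "k - 1"] level_exponent_ge[of k] k1[of k] k1[of "k - 1"] k0[OF k] by linarith
    then show ?thesis by linarith
  qed
  have "sidon_parameters level_exponent k0"
  proof
    show "1 \<le> k0" by (simp add: k0_def)
    show "level_exponent k \<le> k ^ 3" for k by (rule level_exponent_cube)
    show "level_exponent (k - 1) \<le> level_exponent k" if "k \<ge> k0" for k using gap[OF that] by simp
    show "4 * k\<^sup>2 \<le> level_exponent (k - 1)" if "k \<ge> k0" for k
    proof -
      have "real (4 * k\<^sup>2) \<le> real (level_exponent (k - 1))"
        using level_exponent_ge[of "k - 1"] k1[of k] k0[OF that] by simp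
      then show ?thesis by (simp only: of_nat_le_iff)
    qed
    show "2 * level_exponent k \<le> modulus_exponent k" if "k \<ge> k0" for k
    proof -
      have "0 \<le> 7 * real k ^ 2" by simp
      then have "real (level_exponent k) \<le> \<gamma> * real (modulus_exponent k)"
        using level_exponent_le[of k] k1[of k] k0[OF that] unfolding raw_exponent_def real_modulus_exponent by linarith
      also have "\<dots> \<le> (1 / 2) * real (modulus_exponent k)" using gamma_bounds by (intro mult_right_mono) auto
      finally show ?thesis by linarith
    qed
    show "level_exponent k + 2 * level_exponent j + 7 * k\<^sup>2 \<le> modulus_exponent k"
      if "k0 \<le> j" "j < k" "modulus_exponent j \<le> level_exponent k + level_exponent j" for j k
      using that k1[of k] k1[of j] k0[of k] k0[of j] by (intro level_exponent_critical) auto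
  qed
  then show ?thesis using gap k1 k0 by blast
qed

text \<open>By \<open>gap\<close> and the growth condition on \<open>k\<close>, the primes below the lower end of the level make up at
  most half of Chebyshev's bound.\<close>

lemma card_level_ge:
  assumes "sidon_parameters t k0" and k: "k \<ge> 1" and cube: "t k \<le> k ^ 3" "4 * real k ^ 3 \<le> 2 ^ k"
    and gap: "t (k - 1) + k \<le> t k"
  shows "2 ^ t k / (4 * real k ^ 3) \<le> real (card (sidon_parameters.level t k))"
proof -
  interpret sidon_parameters t k0 by fact
  define n where "n = t k"
  define m where "m = t (k - 1)"
  have n: "n \<ge> 1" "m + k \<le> n" using gap k by (auto simp: n_def m_def)
  have "{p. prime p \<and> p \<le> 2 ^ n} \<subseteq> level k \<union> {1..2 ^ m}"
    unfolding level_def n_def m_def by (auto simp: not_less Suc_leI prime_gt_0_nat)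
  then have "card {p::nat. prime p \<and> p \<le> 2 ^ n} \<le> card (level k \<union> {1..2 ^ m})"
    by (intro card_mono) (simp_all add: finite_level)
  also have "\<dots> \<le> card (level k) + 2 ^ m"
    using card_Un_le[of "level k" "{1..2 ^ m}"] by simp
  finally have "n * card {p::nat. prime p \<and> p \<le> 2 ^ n} \<le> n * (card (level k) + 2 ^ m)" by (rule mult_left_mono) simp
  then have "2 ^ (n - 1) \<le> n * (card (level k) + 2 ^ m)"
    using card_primes_le_two_power[OF n(1)] by linarith
  then have "real (2 ^ (n - 1)) \<le> real (n * (card (level k) + 2 ^ m))" by (rule of_nat_mono)
  then have 1: "2 ^ n \<le> 2 * real n * (real (card (level k)) + 2 ^ m)"
    using n(1) by (cases n) (simp_all add: algebra_simps)
  have nk: "real n \<le> real k ^ 3" using cube(1) unfolding n_def by (metis of_nat_le_iff of_nat_power)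
  have "4 * real n \<le> 2 ^ k" using nk cube(2) by linarith
  then have "4 * real n * 2 ^ m \<le> 2 ^ k * 2 ^ m" by (rule mult_right_mono) simp
  also have "\<dots> = 2 ^ (m + k)" by (simp add: power_add)
  also have "\<dots> \<le> (2::real) ^ n" using n(2) by (intro power_increasing) auto
  finally have "2 ^ n \<le> 4 * real n * real (card (level k))" using 1 by (simp add: algebra_simps)
  also have "\<dots> \<le> 4 * real k ^ 3 * real (card (level k))" using nk by (intro mult_right_mono) auto
  finally show ?thesis using k by (simp add: n_def field_simps)
qed

theorem ex_dense_sidon_set:
  "\<exists>B. sidon B \<and> B \<subseteq> {0<..} \<and> (\<forall>\<^sub>F k in sequentially.
    2 powr (raw_exponent k - 1) / (8 * real k ^ 3) \<le> real (card {b\<in>B. b < 2 ^ code_exponent k}))"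
proof -
  obtain k0 where par: "sidon_parameters level_exponent k0"
    "\<And>k. k \<ge> k0 \<Longrightarrow> 4 * real k ^ 3 \<le> 2 ^ k \<and> level_exponent (k - 1) + k \<le> level_exponent k"
    using ex_sidon_parameters by blast
  interpret sidon_parameters level_exponent k0 by (rule par(1))
  obtain B where B: "sidon B" "B \<subseteq> {0<..}"
    "\<And>k. k \<ge> k0 \<Longrightarrow> card (level k) \<le> 2 * card {b\<in>B. b < int (\<Prod>i<k. base i)}"
    using ex_sidon_set by blast
  have "2 powr (raw_exponent k - 1) / (8 * real k ^ 3) \<le> real (card {b\<in>B. b < 2 ^ code_exponent k})"
    if k: "k \<ge> k0" for k
  proof -
    have k1: "k \<ge> 1" using k sidon_parameters.k0[OF par(1)] by simp
    have "2 powr (raw_exponent k - 1) \<le> 2 powr real (level_exponent k)"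
      using level_exponent_ge by (intro powr_mono) auto
    also have "\<dots> = 2 ^ level_exponent k" by (simp add: powr_realpow)
    finally have "2 powr (raw_exponent k - 1) / (8 * real k ^ 3) \<le> 2 ^ level_exponent k / (8 * real k ^ 3)"
      by (rule divide_right_mono) simp
    also have "\<dots> = (2 ^ level_exponent k / (4 * real k ^ 3)) / 2" by simp
    also have "\<dots> \<le> real (card (level k)) / 2"
      using card_level_ge[OF par(1) k1 level_exponent_cube] par(2)[OF k] by simp
    also have "\<dots> \<le> real (card {b\<in>B. b < int (\<Prod>i<k. base i)})"
      using of_nat_mono[OF B(3)[OF k], where 'a = real] by simp
    also have "int (\<Prod>i<k. base i) = 2 ^ code_exponent k" by (simp add: prod_base del: of_nat_prod)
    finally show ?thesis .
  qed
  then show ?thesis using B(1,2) unfolding eventually_sequentially by blast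
qed

section \<open>The counting function\<close>

text \<open>Passing from \<open>B\<close> to the tripled set costs a constant factor in the argument, and the removed elements
  cost a logarithm.\<close>

lemma card_tripled_minus_sparse:
  fixes B R A :: "int set" and x :: real and y :: int
  assumes B: "B \<subseteq> {0<..}" and R: "R \<subseteq> {0<..}" "log_sparse R" and A: "(\<lambda>b. 3 * b) ` B - R \<subseteq> A"
    and y: "0 \<le> y" "3 * real_of_int y \<le> x"
  shows "real (card {b\<in>B. b < y}) \<le> real (counting_function A x) + log 2 (x + 1)"
proof -
  let ?S = "(\<lambda>b. 3 * b) ` {b\<in>B. b < y}"
  define z where "z = \<lfloor>x\<rfloor>"
  have z: "0 \<le> z" "3 * y \<le> z" using y unfolding z_def by (auto simp: le_floor_iff)
  have finA: "finite {a\<in>A. 0 < a \<and> real_of_int a \<le> x}"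
    by (rule finite_subset[of _ "{0..z}"]) (auto simp: z_def le_floor_iff)
  have finR: "finite (R \<inter> {..z})"
    by (rule finite_subset[of _ "{0..z}"]) (use R in auto)
  have "?S \<subseteq> {a\<in>A. 0 < a \<and> real_of_int a \<le> x} \<union> (R \<inter> {..z})"
  proof
    fix a assume "a \<in> ?S"
    then obtain b where b: "b \<in> B" "b < y" "a = 3 * b" by blast
    have "0 < a" "a \<le> z" using b B z by auto
    moreover from this have "real_of_int a \<le> x" unfolding z_def by (simp add: le_floor_iff)
    ultimately show "a \<in> {a\<in>A. 0 < a \<and> real_of_int a \<le> x} \<union> (R \<inter> {..z})" using A b by auto
  qed
  then have "card ?S \<le> card ({a\<in>A. 0 < a \<and> real_of_int a \<le> x} \<union> (R \<inter> {..z}))"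
    by (intro card_mono finite_UnI finA finR)
  also have "\<dots> \<le> counting_function A x + card (R \<inter> {..z})"
    unfolding counting_function_def by (rule card_Un_le)
  finally have "card ?S \<le> counting_function A x + card (R \<inter> {..z})" .
  moreover have "card ?S = card {b\<in>B. b < y}" by (intro card_image) (simp add: inj_on_def)
  moreover have "real (card (R \<inter> {..z})) \<le> log 2 (x + 1)"
  proof -
    have "2 ^ card (R \<inter> {..z}) \<le> z + 1" using R(2) z(1) unfolding log_sparse_def by blast
    then have "real_of_int (2 ^ card (R \<inter> {..z})) \<le> real_of_int (z + 1)" by (simp only: of_int_le_iff)
    also have "\<dots> \<le> x + 1" unfolding z_def by simp
    finally have "2 powr real (card (R \<inter> {..z})) \<le> x + 1" by (simp add: powr_realpow)
    then show ?thesis using y by (subst le_log_iff) auto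
  qed
  ultimately show ?thesis by linarith
qed

text \<open>A point \<open>x\<close> between the codes of levels \<open>k\<close> and \<open>k + 1\<close> has size at most \<open>2 ^ (S + 2)\<close>, where \<open>S\<close>
  is the code exponent of level \<open>k + 1\<close>, whereas the elements counted below \<open>x\<close> are those of level \<open>k\<close>.
  This is harmless since both \<open>S\<close> and \<open>F k\<close> are asymptotic to \<open>4/3 k\<^sup>3\<close>.\<close>

lemma eventually_exponents_beat_power:
  assumes \<epsilon>: "\<epsilon> > 0"
  shows "\<forall>\<^sub>F k in sequentially. (real (code_exponent (Suc k)) + 2) * (\<gamma> - \<epsilon>) \<le>
      log 2 (2 powr (raw_exponent k - 1) / (8 * real k ^ 3) - (real (code_exponent (Suc k)) + 3))
    \<and> 0 < 2 powr (raw_exponent k - 1) / (8 * real k ^ 3) - (real (code_exponent (Suc k)) + 3)"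
proof -
  let ?f = "\<lambda>k. 2 powr (raw_exponent k - 1) / (8 * real k ^ 3) - (real (code_exponent (Suc k)) + 3)"
  have "(\<lambda>k. log 2 (?f k) / (real (code_exponent (Suc k)) + 2)) \<longlonglongrightarrow> \<gamma>"
    unfolding raw_exponent_def real_code_exponent of_nat_Suc
    by real_asymp (simp add: sqrt_def field_simps)
  then have "\<forall>\<^sub>F k in sequentially. log 2 (?f k) / (real (code_exponent (Suc k)) + 2) > \<gamma> - \<epsilon>"
    by (rule order_tendstoD) (use \<epsilon> in simp)
  moreover have "\<forall>\<^sub>F k in sequentially. 0 < ?f k"
    unfolding raw_exponent_def real_code_exponent of_nat_Suc by real_asymp
  ultimately show ?thesis
    by eventually_elim (auto simp: field_simps add_pos_nonneg)
qed

lemma between_consecutive_values: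
  fixes f :: "nat \<Rightarrow> real"
  assumes f: "filterlim f at_top sequentially" and x: "f m \<le> x"
  shows "\<exists>k\<ge>m. f k \<le> x \<and> x < f (Suc k)"
proof (rule ccontr)
  assume no: "\<not> ?thesis"
  have "f k \<le> x" if "m \<le> k" for k
    using that
  proof (induction k rule: dec_induct)
    case (step n)
    then show ?case using no by (meson not_le)
  qed (rule x)
  moreover have "\<forall>\<^sub>F k in sequentially. x < f k" using f by (simp add: filterlim_at_top_dense)
  ultimately show False unfolding eventually_sequentially by (meson linorder_not_le nat_le_linear)
qed

lemma counting_function_lower_bound:
  assumes B: "B \<subseteq> {0<..}" and dense: "\<forall>\<^sub>F k in sequentially.
      2 powr (raw_exponent k - 1) / (8 * real k ^ 3) \<le> real (card {b\<in>B. b < 2 ^ code_exponent k})"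
    and R: "R \<subseteq> {0<..}" "log_sparse R" and A: "(\<lambda>b. 3 * b) ` B - R \<subseteq> A"
    and \<epsilon>: "0 < \<epsilon>" "\<epsilon> < \<gamma>"
  shows "\<forall>\<^sub>F x in at_top. x powr (\<gamma> - \<epsilon>) \<le> real (counting_function A x)"
proof -
  obtain m where m: "\<And>k. k \<ge> m \<Longrightarrow>
      2 powr (raw_exponent k - 1) / (8 * real k ^ 3) \<le> real (card {b\<in>B. b < 2 ^ code_exponent k}) \<and>
      (real (code_exponent (Suc k)) + 2) * (\<gamma> - \<epsilon>) \<le>
        log 2 (2 powr (raw_exponent k - 1) / (8 * real k ^ 3) - (real (code_exponent (Suc k)) + 3)) \<and>
      0 < 2 powr (raw_exponent k - 1) / (8 * real k ^ 3) - (real (code_exponent (Suc k)) + 3)"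
    using eventually_conj[OF dense eventually_exponents_beat_power[OF \<epsilon>(1)]]
    unfolding eventually_sequentially by blast
  define f where "f k = 3 * 2 powr real (code_exponent k)" for k
  have lim: "filterlim f at_top sequentially"
    unfolding f_def real_code_exponent by real_asymp
  have "x powr (\<gamma> - \<epsilon>) \<le> real (counting_function A x)" if x: "f m \<le> x" for x
  proof -
    obtain k where k: "k \<ge> m" "f k \<le> x" "x < f (Suc k)"
      using between_consecutive_values[OF lim x] by blast
    let ?s = "real (code_exponent (Suc k))"
    let ?g = "2 powr (raw_exponent k - 1) / (8 * real k ^ 3) - (?s + 3)"
    have fpos: "0 < f k" by (simp add: f_def)
    have x1: "1 \<le> x"
      using k(2) ge_one_powr_ge_zero[of 2 "real (code_exponent k)"] unfolding f_def by simp
    have x4: "x \<le> 2 powr (?s + 2)"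
    proof -
      have "2 powr (?s + 2) = 4 * 2 powr ?s" by (simp add: powr_add)
      moreover have "0 \<le> 2 powr ?s" by simp
      ultimately show ?thesis using k(3) unfolding f_def by linarith
    qed
    have "x + 1 \<le> 2 powr (?s + 3)"
    proof -
      have "2 powr (?s + 3) = 2 * 2 powr (?s + 2)" by (simp add: powr_add)
      then show ?thesis using x4 x1 by linarith
    qed
    then have log: "log 2 (x + 1) \<le> ?s + 3" using x1 by (subst log_le_iff) auto
    have "3 * real_of_int (2 ^ code_exponent k) \<le> x" using k(2) unfolding f_def by (simp add: powr_realpow)
    then have "real (card {b\<in>B. b < 2 ^ code_exponent k}) \<le> real (counting_function A x) + log 2 (x + 1)"
      using card_tripled_minus_sparse[OF B R A, of "2 ^ code_exponent k" x] by simp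
    then have g: "?g \<le> real (counting_function A x)" using m[OF k(1)] log by linarith
    have "x powr (\<gamma> - \<epsilon>) \<le> (2 powr (?s + 2)) powr (\<gamma> - \<epsilon>)"
      using x4 x1 \<epsilon> by (intro powr_mono2) auto
    also have "\<dots> = 2 powr ((?s + 2) * (\<gamma> - \<epsilon>))" by (rule powr_powr)
    also have "\<dots> \<le> 2 powr (log 2 ?g)" using m[OF k(1)] by (intro powr_mono) auto
    also have "\<dots> = ?g" using m[OF k(1)] by simp
    finally show ?thesis using g by linarith
  qed
  then show ?thesis unfolding eventually_at_top_linorder by blast
qed

text \<open>The error term is the true exponent \<open>ln (f x) / ln x\<close> minus \<open>c\<close>, cut off at \<open>0\<close> because \<open>f\<close> may
  be larger than a power with exponent \<open>c\<close>.\<close>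

lemma exponent_from_lower_bounds:
  fixes f :: "real \<Rightarrow> real" and c :: real
  assumes c: "c > 0" and f: "\<And>\<epsilon>. 0 < \<epsilon> \<Longrightarrow> \<epsilon> < c \<Longrightarrow> \<forall>\<^sub>F x in at_top. x powr (c - \<epsilon>) \<le> f x"
  shows "\<exists>\<eta>. (\<eta> \<longlongrightarrow> 0) at_top \<and> (\<forall>\<^sub>F x in at_top. x powr (c + \<eta> x) \<le> f x)"
proof -
  define \<eta> where "\<eta> x = min 0 (ln (f x) / ln x - c)" for x
  have big: "\<forall>\<^sub>F x::real in at_top. x > 1" by (rule eventually_gt_at_top)
  have pos: "\<forall>\<^sub>F x in at_top. 0 < f x"
    using f[of "c / 2", simplified, OF c] big
  proof eventually_elim
    case (elim x)
    have "0 < x powr (c / 2)" using elim(2) by simp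
    then show ?case using elim(1) by linarith
  qed
  have "(\<eta> \<longlongrightarrow> 0) at_top"
  proof (rule order_tendstoI)
    fix a :: real assume a: "a < 0"
    define \<epsilon> where "\<epsilon> = min (- a / 2) (c / 2)"
    have \<epsilon>: "0 < \<epsilon>" "\<epsilon> < c" "a < - \<epsilon>" using a c by (auto simp: \<epsilon>_def min_def)
    show "\<forall>\<^sub>F x in at_top. a < \<eta> x"
      using f[OF \<epsilon>(1,2)] big
    proof eventually_elim
      case (elim x)
      have "0 < x powr (c - \<epsilon>)" using elim(2) by simp
      then have "ln (x powr (c - \<epsilon>)) \<le> ln (f x)" using ln_le_cancel_iff[of "x powr (c - \<epsilon>)" "f x"] elim(1) by linarith
      then have "(c - \<epsilon>) * ln x \<le> ln (f x)" using elim(2) by (simp add: ln_powr)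
      then have "c - \<epsilon> \<le> ln (f x) / ln x" using elim(2) by (simp add: pos_le_divide_eq)
      then show ?case using a \<epsilon>(3) by (simp add: \<eta>_def)
    qed
  next
    fix a :: real assume "0 < a"
    then show "\<forall>\<^sub>F x in at_top. \<eta> x < a" by (simp add: \<eta>_def min_def)
  qed
  moreover have "\<forall>\<^sub>F x in at_top. x powr (c + \<eta> x) \<le> f x"
    using pos big
  proof eventually_elim
    case (elim x)
    have "x powr (c + \<eta> x) \<le> x powr (ln (f x) / ln x)"
      using elim(2) by (intro powr_mono) (auto simp: \<eta>_def)
    also have "\<dots> = f x" using elim by (simp add: powr_def)
    finally show ?case .
  qed
  ultimately show ?thesis by blast
qed

theorem theorem2:
  shows "\<exists>A :: int set. A \<subseteq> {0<..} \<and> perfect_difference_set A \<and>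
    (\<exists>(C::real) (\<eta> :: real \<Rightarrow> real). C > 0 \<and> (\<eta> \<longlongrightarrow> 0) at_top \<and>
      (\<forall>\<^sub>F x in at_top. real (counting_function A x) \<ge> C * x powr (sqrt 2 - 1 + \<eta> x)))"
proof -
  obtain B where B: "sidon B" "B \<subseteq> {0<..}" and dense: "\<forall>\<^sub>F k in sequentially.
      2 powr (raw_exponent k - 1) / (8 * real k ^ 3) \<le> real (card {b\<in>B. b < 2 ^ code_exponent k})"
    using ex_dense_sidon_set by blast
  let ?B3 = "(\<lambda>b. 3 * b) ` B"
  have "sidon ?B3"
    unfolding sidon_def
  proof (intro ballI impI)
    fix a b c d assume "a \<in> ?B3" "b \<in> ?B3" "c \<in> ?B3" "d \<in> ?B3" and eq: "a + b = c + d"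
    then obtain a' b' c' d' where "a' \<in> B" "b' \<in> B" "c' \<in> B" "d' \<in> B"
      and m: "a = 3 * a'" "b = 3 * b'" "c = 3 * c'" "d = 3 * d'" by blast
    then show "(a = c \<and> b = d) \<or> (a = d \<and> b = c)" using sidonD[OF B(1), of a' b' c' d'] eq by simp
  qed
  moreover have "?B3 \<subseteq> {0<..}" using B(2) by auto
  moreover have "3 dvd b" if "b \<in> ?B3" for b using that by auto
  ultimately obtain A R where A: "A \<subseteq> {0<..}" "perfect_difference_set A" "?B3 - R \<subseteq> A"
    and R: "R \<subseteq> {0<..}" "log_sparse R"
    using sidon_extends_to_perfect_difference_set[of ?B3] by blast
  obtain \<eta> where "(\<eta> \<longlongrightarrow> 0) at_top"
    "\<forall>\<^sub>F x in at_top. x powr (\<gamma> + \<eta> x) \<le> real (counting_function A x)"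
    using exponent_from_lower_bounds[OF gamma_bounds(1) counting_function_lower_bound[OF B(2) dense R A(3)]] by blast
  then show ?thesis using A(1,2) by (intro exI[of _ A] conjI exI[of _ 1] exI[of _ \<eta>]) auto
qed

end
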